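(* Let $\Phi=(\phi_1,\dots,\phi_K)$ be a unit norm tight frame in $\mathbb{R}^d$ with frame constant $A=K/d$ and coherence $\mu$. Let signals be generated as $y=\Phi x+r$, where $r$ is a random noise vector independent of $x$ with $\|r\|_2\le\rho_{\max}$ almost surely, $\mathbb{E}(r)=0$ and $\mathbb{E}(rr^\star)=\rho^2 I$, and where $x$ is drawn from a symmetric probability distribution $\nu$ on $S^{K-1}$ with $\mathbb{E}_x\|x\|_\infty^2=\bar c_1^2$. Assume there exists $\beta<1/2$ such that $$\nu\Big(\frac{c_2(x)+\mu\|c(x)\|_1+\rho_{\max}}{c_1(x)-c_2(x)}\le\beta\Big)=1.$$ Then $\Phi$ is a local maximum of $\max_{\Psi\in\mathcal D}\mathbb{E}_y\|\Psi^\star y\|_\infty^2$, and for all $\Psi\in\mathcal D$ with $0<\max_i\|\psi_i-\phi_i\|_2\le\varepsilon$ we have $\mathbb{E}_y\|\Psi^\star y\|_\infty^2<\mathbb{E}_y\|\Phi^\star y\|_\infty^2$ as soon as $\varepsilon<1/5$ and $$\varepsilon\le\frac{(1-2\beta)^2}{2A\log\Big(2AK\big/\big(\bar c_1^2-\frac{1-\bar c_1^2}{K-1}\big)\Big)}.$$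
   Context: $\mathcal D$ is the set of dictionaries $\Psi=(\psi_1,\dots,\psi_K)$, $\psi_i\in\mathbb{R}^d$, $\|\psi_i\|_2=1$. Unit norm tight frame with frame constant $A$: $\sum_i|\langle\phi_i,v\rangle|^2=A\|v\|_2^2$ for all $v$; coherence $\mu=\max_{i\ne j}|\langle\phi_i,\phi_j\rangle|$. A probability measure $\nu$ on $S^{K-1}\subset\mathbb{R}^K$ is symmetric if it is invariant under flipping signs of any coordinates and under any permutation of coordinates. For $x\in S^{K-1}$, $c_1(x)\ge\dots\ge c_K(x)\ge0$ is the non-increasing rearrangement of $(|x_1|,\dots,|x_K|)$, $c(x)$ the resulting vector. *)

theory Defs
  imports "HOL-Probability.Probability" "HOL-Library.Multiset"
begin

text \<open>Atoms are indexed by a finite type 'k (so K = CARD('k)); signals live in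
  real^'d (so d = CARD('d)).\<close>

definition dictionary :: "('k::finite \<Rightarrow> real^'d) set" where
  "dictionary = {\<Psi>. \<forall>i. norm (\<Psi> i) = 1}"

definition unit_norm_tight_frame :: "('k::finite \<Rightarrow> real^'d) \<Rightarrow> real \<Rightarrow> bool" where
  "unit_norm_tight_frame \<Phi> A \<longleftrightarrow> \<Phi> \<in> dictionary \<and>
     (\<forall>v::real^'d. (\<Sum>i\<in>UNIV. (\<Phi> i \<bullet> v)^2) = A * (norm v)^2)"

definition coherence :: "('k::finite \<Rightarrow> real^'d) \<Rightarrow> real" where
  "coherence \<Phi> = Max {\<bar>\<Phi> i \<bullet> \<Phi> j\<bar> | i j. i \<noteq> j}"

definition synth :: "('k::finite \<Rightarrow> real^'d) \<Rightarrow> real^'k \<Rightarrow> real^'d" where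
  "synth \<Phi> x = (\<Sum>i\<in>UNIV. x$i *\<^sub>R \<Phi> i)"

definition analysis_linf_sq :: "('k::finite \<Rightarrow> real^'d) \<Rightarrow> real^'d \<Rightarrow> real" where
  "analysis_linf_sq \<Psi> y = (Max (range (\<lambda>i. \<bar>\<Psi> i \<bullet> y\<bar>)))^2"

definition linf_norm :: "real^'k::finite \<Rightarrow> real" where
  "linf_norm x = Max (range (\<lambda>i. \<bar>x$i\<bar>))"

text \<open>Objective E_y \<parallel>\<Psi>* y\<parallel>_\<infinity>^2 with y = \<Phi> x + r, x ~ nu and r ~ R independent
  (joint law = product measure).\<close>
definition objective ::
  "('k::finite \<Rightarrow> real^'d) \<Rightarrow> (real^'k) measure \<Rightarrow> (real^'d) measure \<Rightarrow> ('k \<Rightarrow> real^'d) \<Rightarrow> real" where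
  "objective \<Phi> nu R \<Psi> =
     integral\<^sup>L (nu \<Otimes>\<^sub>M R) (\<lambda>(x, r). analysis_linf_sq \<Psi> (synth \<Phi> x + r))"

definition symmetric_measure :: "(real^'k::finite) measure \<Rightarrow> bool" where
  "symmetric_measure nu \<longleftrightarrow>
     (\<forall>s::'k \<Rightarrow> real. (\<forall>i. s i = 1 \<or> s i = -1) \<longrightarrow>
         distr nu borel (\<lambda>x. \<chi> i. s i * x$i) = nu) \<and>
     (\<forall>p::'k \<Rightarrow> 'k. bij p \<longrightarrow> distr nu borel (\<lambda>x. \<chi> i. x$(p i)) = nu)"

text \<open>Non-increasing rearrangement c(x) of (|x_1|,...,|x_K|), as a list of length K,
  and its 1-indexed entries c_j(x).\<close>
definition crearr :: "real^'k::finite \<Rightarrow> real list" where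
  "crearr x = rev (sorted_list_of_multiset (image_mset (\<lambda>i. \<bar>x$i\<bar>) (mset_set (UNIV::'k set))))"

definition cc :: "real^'k::finite \<Rightarrow> nat \<Rightarrow> real" where
  "cc x j = crearr x ! (j - 1)"

definition c_l1 :: "real^'k::finite \<Rightarrow> real" where
  "c_l1 x = sum_list (map abs (crearr x))"

end

theory Submission
  imports Defs
begin

text \<open>
  Almost surely one coefficient dominates, say at index \<open>i(x)\<close>. If the maximum is replaced by the
  response of the atom \<open>i(x)\<close>, then the signs kill the cross terms and permutation invariance
  shows that passing from \<open>\<Phi>\<close> to \<open>\<Psi>\<close> loses exactly
  \<open>\<lambda>/K * (\<Sum>\<^sub>i 1 - \<langle>\<psi>\<^sub>i, \<phi>\<^sub>i\<rangle>\<^sup>2)\<close>, where \<open>\<lambda> = C - (1 - C) / (K - 1)\<close> and \<open>C\<close> is the mean of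
  \<open>c\<^sub>1(x)\<^sup>2\<close>. This is at least \<open>0.99 \<lambda> e\<^sup>2 / K\<close> for \<open>e = max\<^sub>i \<parallel>\<psi>\<^sub>i - \<phi>\<^sub>i\<parallel>\<close>.
  For \<open>\<Phi>\<close> the replacement can only lower the objective. For \<open>\<Psi>\<close> another atom wins only if,
  for some \<open>l\<close>, the Rademacher sum of the numbers \<open>x\<^sub>j \<langle>\<psi>\<^sub>l - \<phi>\<^sub>l, \<phi>\<^sub>j\<rangle>\<close> over \<open>j \<noteq> i(x)\<close> exceeds
  \<open>m = c\<^sub>2 + (1 - 2\<beta>)(c\<^sub>1 - c\<^sub>2) / 8\<close>. Its variance is at most \<open>v = A e\<^sup>2 c\<^sub>2\<^sup>2\<close>, and AM-GM on the two
  terms of \<open>m\<close> together with the bound on \<open>\<epsilon>\<close> gives \<open>m\<^sup>2 / (2v) \<ge> 4 log(2AK/\<lambda>) / e\<close>. Hence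
  the expected excess is at most \<open>C e\<^sup>2 / (2K)\<close>, which is smaller than the gain because
  \<open>c\<^sub>2 \<le> c\<^sub>1 / 3\<close> forces \<open>\<lambda> \<ge> 8/9 C\<close>.
\<close>

section \<open>Random signs\<close>

text \<open>Sums over this finite set, divided by its cardinality, serve as expectations over
  independent Rademacher signs.\<close>

definition signs :: "('k::finite \<Rightarrow> real) set" where
  "signs = {s. \<forall>i. s i = 1 \<or> s i = -1}"

definition flip :: "('k::finite \<Rightarrow> real) \<Rightarrow> real^'k \<Rightarrow> real^'k" where
  "flip s x = (\<chi> i. s i * x$i)"

lemma flip_nth [simp]: "flip s x $ i = s i * x $ i"
  by (simp add: flip_def)

lemma signs_eq_PiE: "signs = (\<Pi>\<^sub>E i\<in>UNIV. {1, -1})"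
  by (auto simp: signs_def PiE_def Pi_def)

lemma finite_signs [simp]: "finite signs"
  unfolding signs_eq_PiE by (intro finite_PiE) auto

lemma card_signs_pos: "card (signs :: ('k::finite \<Rightarrow> real) set) > 0"
proof -
  have "(\<lambda>_. 1) \<in> (signs :: ('k \<Rightarrow> real) set)" by (simp add: signs_def)
  then show ?thesis by (metis card_gt_0_iff empty_iff finite_signs)
qed

lemma signsD: "s \<in> signs \<Longrightarrow> \<bar>s i\<bar> = 1" "s \<in> signs \<Longrightarrow> s i * s i = 1"
  by (cases "s i = 1"; force simp: signs_def)+

text \<open>Negating the \<open>j\<close>-th sign is an involution of \<open>signs\<close> that
  reverses \<open>s j * s k\<close> for \<open>j \<noteq> k\<close>, so only the diagonal of the
  expanded square survives.\<close>

lemma sum_signs_square: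
  fixes b :: "'k::finite \<Rightarrow> real"
  shows "(\<Sum>s\<in>signs. (\<Sum>j\<in>UNIV. s j * b j)\<^sup>2) = real (card (signs :: ('k \<Rightarrow> real) set)) * (\<Sum>j\<in>UNIV. (b j)\<^sup>2)"
proof -
  have offdiag: "(\<Sum>s\<in>signs. s j * s k) = 0" if "j \<noteq> k" for j k :: 'k
  proof -
    have "(\<Sum>s\<in>signs. s j * s k) = (\<Sum>s\<in>signs. - (s j * s k))"
      by (rule sum.reindex_bij_witness[of _ "\<lambda>s. s(j := - s j)" "\<lambda>s. s(j := - s j)"])
         (use that in \<open>auto simp: signs_def\<close>)
    then show ?thesis by (simp add: sum_negf)
  qed
  have "(\<Sum>s\<in>signs. (\<Sum>j\<in>UNIV. s j * b j)\<^sup>2)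
      = (\<Sum>s\<in>signs. \<Sum>j\<in>UNIV. \<Sum>k\<in>UNIV. (s j * s k) * (b j * b k))"
    by (simp add: power2_eq_square sum_product mult_ac)
  also have "\<dots> = (\<Sum>j\<in>UNIV. \<Sum>k\<in>UNIV. (\<Sum>s\<in>signs. s j * s k) * (b j * b k))"
    by (subst sum.swap, intro sum.cong refl, subst sum.swap) (simp add: sum_distrib_right)
  also have "\<dots> = (\<Sum>j\<in>UNIV. \<Sum>k\<in>UNIV. if j = k then real (card (signs :: ('k \<Rightarrow> real) set)) * (b j)\<^sup>2 else 0)"
    by (intro sum.cong refl) (auto simp: offdiag signsD power2_eq_square)
  also have "\<dots> = real (card (signs :: ('k \<Rightarrow> real) set)) * (\<Sum>j\<in>UNIV. (b j)\<^sup>2)"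
    by (simp add: sum_distrib_left)
  finally show ?thesis .
qed

section \<open>Sub-Gaussian bounds for Rademacher sums\<close>

lemma cosh_le_exp_half_square:
  fixes x :: real
  shows "cosh x \<le> exp (x\<^sup>2 / 2)"
proof -
  have *: "cosh x \<le> exp (x\<^sup>2 / 2)" if "x \<ge> 0" for x :: real
  proof -
    have pos: "1 + 1/2 * (exp (2*x) - 1) > (0::real)"
      by (simp add: field_simps add_pos_pos)
    \<comment> \<open>Hoeffding's auxiliary inequality at probability 1/2 and interval length
      \<open>2*x\<close>; the argument of the logarithm is \<open>exp x * cosh x\<close>.\<close>
    have "ln (1 + 1/2 * (exp (2*x) - 1)) \<le> x + x\<^sup>2 / 2"
      using Hoeffdings_lemma_aux[of "2*x" "1/2"] that by (simp add: power2_eq_square)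
    then have "1 + 1/2 * (exp (2*x) - 1) \<le> exp (x + x\<^sup>2 / 2)"
      using pos by (metis exp_le_cancel_iff exp_ln)
    moreover have "1 + 1/2 * (exp (2*x) - 1) = exp x * cosh x"
      by (simp add: cosh_field_def algebra_simps add_divide_distrib flip: exp_add)
    ultimately show ?thesis
      by (simp add: exp_add)
  qed
  show ?thesis
    using *[of x] *[of "-x"] by (cases "x \<ge> 0") auto
qed

text \<open>\<open>signs\<close> is a product set, so the exponential sum splits into one factor
  \<open>2 * cosh (b j)\<close> per coordinate.\<close>

lemma sum_signs_exp_le:
  fixes b :: "'k::finite \<Rightarrow> real"
  shows "(\<Sum>s\<in>signs. exp (\<Sum>j\<in>UNIV. s j * b j))
    \<le> real (card (signs :: ('k \<Rightarrow> real) set)) * exp ((\<Sum>j\<in>UNIV. (b j)\<^sup>2) / 2)"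
proof -
  have "(\<Sum>s\<in>signs. exp (\<Sum>j\<in>UNIV. s j * b j)) = (\<Prod>j\<in>UNIV. \<Sum>t\<in>{1,-1}. exp (t * b j))"
    unfolding signs_eq_PiE by (subst prod_sum_PiE) (auto simp: exp_sum)
  also have "\<dots> = (\<Prod>j\<in>UNIV. 2 * cosh (b j))"
    by (intro prod.cong refl) (simp add: cosh_field_def field_simps)
  also have "\<dots> \<le> (\<Prod>j\<in>UNIV. 2 * exp ((b j)\<^sup>2 / 2))"
    by (intro prod_mono conjI mult_left_mono cosh_le_exp_half_square)
       (auto simp: cosh_real_nonneg)
  also have "\<dots> = real (card (signs :: ('k \<Rightarrow> real) set)) * exp ((\<Sum>j\<in>UNIV. (b j)\<^sup>2) / 2)"
    by (simp add: prod.distrib signs_eq_PiE card_PiE sum_divide_distrib exp_sum numeral_2_eq_2)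
  finally show ?thesis .
qed

text \<open>The absolute value is removed by adding the exponentials at \<open>t\<close> and
  \<open>-t\<close>, which is the source of the factor 2.\<close>

lemma sum_signs_exp_abs_le:
  fixes b :: "'k::finite \<Rightarrow> real"
  assumes "(\<Sum>j\<in>UNIV. (b j)\<^sup>2) \<le> v"
  shows "(\<Sum>s\<in>signs. exp (t * \<bar>\<Sum>j\<in>UNIV. s j * b j\<bar>))
    \<le> 2 * real (card (signs :: ('k \<Rightarrow> real) set)) * exp (t\<^sup>2 * v / 2)"
proof -
  have *: "(\<Sum>s\<in>signs. exp (u * (\<Sum>j\<in>UNIV. s j * b j)))
      \<le> real (card (signs :: ('k \<Rightarrow> real) set)) * exp (t\<^sup>2 * v / 2)" if "u\<^sup>2 = t\<^sup>2" for u
  proof -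
    have "(\<Sum>s\<in>signs. exp (u * (\<Sum>j\<in>UNIV. s j * b j)))
        \<le> real (card (signs :: ('k \<Rightarrow> real) set)) * exp ((\<Sum>j\<in>UNIV. (u * b j)\<^sup>2) / 2)"
      using sum_signs_exp_le[of "\<lambda>j. u * b j"] by (simp add: sum_distrib_left mult_ac)
    also have "(\<Sum>j\<in>UNIV. (u * b j)\<^sup>2) = t\<^sup>2 * (\<Sum>j\<in>UNIV. (b j)\<^sup>2)"
      using that by (simp add: power_mult_distrib sum_distrib_left)
    also have "\<dots> \<le> t\<^sup>2 * v"
      using assms by (intro mult_left_mono) auto
    finally show ?thesis by (simp add: mult_left_mono)
  qed
  have "(\<Sum>s\<in>signs. exp (t * \<bar>\<Sum>j\<in>UNIV. s j * b j\<bar>))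
      \<le> (\<Sum>s\<in>signs. exp (t * (\<Sum>j\<in>UNIV. s j * b j)) + exp ((-t) * (\<Sum>j\<in>UNIV. s j * b j)))"
    by (intro sum_mono) (auto simp: abs_if)
  also have "\<dots> \<le> 2 * real (card (signs :: ('k \<Rightarrow> real) set)) * exp (t\<^sup>2 * v / 2)"
    using *[of t] *[of "-t"] by (simp add: sum.distrib)
  finally show ?thesis .
qed

section \<open>Sorted coefficients, and the scalar inequalities for margin and tail\<close>

lemma crearr_props:
  fixes x :: "real^'k::finite"
  assumes K2: "CARD('k) \<ge> 2"
  obtains i where "cc x 1 = \<bar>x$i\<bar>" "\<And>j. j \<noteq> i \<Longrightarrow> \<bar>x$j\<bar> \<le> cc x 2" "0 \<le> cc x 2"
    "c_l1 x = (\<Sum>j\<in>UNIV. \<bar>x$j\<bar>)"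
proof -
  let ?f = "\<lambda>i. \<bar>x$i\<bar>"
  let ?M = "image_mset ?f (mset_set (UNIV::'k set))"
  have ms: "mset (crearr x) = ?M"
    by (simp add: crearr_def)
  then have "length (crearr x) = CARD('k)"
    by (metis size_image_mset size_mset size_mset_set)
  with K2 obtain a b ys where ab: "crearr x = a # b # ys"
    by (cases "crearr x"; cases "tl (crearr x)") auto
  have "sorted (rev (crearr x))"
    by (simp add: crearr_def)
  then have srt: "sorted_wrt (\<ge>) (crearr x)"
    by (simp add: sorted_wrt_rev)
  then have bb: "\<And>z. z \<in> set (b # ys) \<Longrightarrow> z \<le> b"
    unfolding ab by auto
  have "a \<in># ?M" using ms ab by (metis list.set_intros(1) set_mset_mset)
  then obtain i where i: "a = \<bar>x$i\<bar>" by auto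
  \<comment> \<open>Only one occurrence of the maximum is removed; a tie stays among the rest and is
    covered because then \<open>b = a\<close>.\<close>
  have "mset_set (UNIV::'k set) = add_mset i (mset_set (UNIV - {i}))"
    by (metis UNIV_I finite_class.finite_UNIV mset_set.remove)
  with ms ab i have rest: "image_mset ?f (mset_set (UNIV - {i})) = mset (b # ys)"
    by simp
  have le: "\<bar>x$j\<bar> \<le> b" if "j \<noteq> i" for j
  proof -
    have "\<bar>x$j\<bar> \<in># image_mset ?f (mset_set (UNIV - {i}))"
      using that by auto
    then show ?thesis unfolding rest using bb by auto
  qed
  have "b \<in># ?M" using ms ab by (metis list.set_intros set_mset_mset)
  then have b0: "0 \<le> b" by auto
  have "c_l1 x = sum_mset (image_mset abs (mset (crearr x)))"
    unfolding c_l1_def by (metis mset_map sum_mset_sum_list)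
  also have "\<dots> = (\<Sum>j\<in>UNIV. \<bar>x$j\<bar>)"
    unfolding ms by (simp add: multiset.map_comp comp_def sum_unfold_sum_mset)
  finally show ?thesis
    using i le b0 ab by (intro that[of i]) (auto simp: cc_def)
qed

text \<open>\<open>M\<close> stands for \<open>\<mu>\<close> times the l1 norm. Everything has to
  fit into \<open>c1 - c2\<close>: hypothesis \<open>q\<close>, used twice, takes the share
  \<open>2*\<beta>\<close>. Of the remaining \<open>1 - 2*\<beta>\<close>, three quarters go to the
  two terms \<open>e * (c1 + \<rho>)\<close> and one quarter to the two terms with denominator
  8.\<close>

lemma margin_le:
  fixes c1 c2 :: real
  assumes "0 \<le> c2" "c2 < c1" "0 \<le> \<rho>" "0 \<le> e" "\<beta> < 1/2" "0 \<le> M"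
    and q: "c2 + M + \<rho> \<le> \<beta> * (c1 - c2)"
    and e: "e * (8/3) \<le> (1 - 2*\<beta>)\<^sup>2"
  shows "c2 + M + \<rho> + e * (c1 + \<rho>) + (c2 + (1 - 2*\<beta>) * (c1 - c2) / 8)
    \<le> c1 - M - \<rho> - e * (c1 + \<rho>) - (c2 + (1 - 2*\<beta>) * (c1 - c2) / 8)"
proof -
  define D where "D = c1 - c2"
  have D: "D > 0" using assms by (simp add: D_def)
  have "0 \<le> \<beta> * D" using q assms unfolding D_def by linarith
  then have b0: "\<beta> \<ge> 0" using D by (simp add: zero_le_mult_iff)
  have "e * (c1 + \<rho>) \<le> e * ((1 + \<beta>) * D)"
    using q assms by (intro mult_left_mono) (auto simp: D_def algebra_simps)
  also have "\<dots> \<le> (3/8) * (1 - 2*\<beta>)\<^sup>2 * ((1 + \<beta>) * D)"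
    using e D b0 by (intro mult_right_mono) auto
  also have "\<dots> = (3/8) * (1 - 2*\<beta>) * D * ((1 - 2*\<beta>) * (1 + \<beta>))"
    by (simp add: power2_eq_square)
  \<comment> \<open>\<open>(1 - 2*\<beta>) * (1 + \<beta>)\<close> equals
    \<open>1 - \<beta> - 2*\<beta>\<^sup>2\<close>, at most 1 since
    \<open>\<beta> \<ge> 0\<close>.\<close>
  also have "\<dots> \<le> (3/8) * (1 - 2*\<beta>) * D * 1"
    using assms D b0 by (intro mult_left_mono) (auto simp: algebra_simps)
  finally show ?thesis
    using q by (simp add: D_def algebra_simps)
qed

text \<open>The right side is the Gaussian tail exponent. To cancel \<open>c2\<^sup>2\<close> in the
  variance, AM-GM supplies one factor \<open>c2\<close> and the gap condition with the bound on
  \<open>e\<close> supplies the other.\<close>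

lemma tail_exponent_ge:
  fixes c1 c2 :: real
  assumes "0 < c2" "c2 < c1" "0 < e" "\<beta> < 1/2" "0 < A"
    and c2: "c2 \<le> \<beta> * (c1 - c2)"
    and e: "e * (2 * A * L) \<le> (1 - 2*\<beta>)\<^sup>2"
  shows "4 * L / e \<le> (c2 + (1 - 2*\<beta>) * (c1 - c2) / 8)\<^sup>2 / (2 * (A * e\<^sup>2 * c2\<^sup>2))"
proof -
  define s where "s = 1 - 2*\<beta>"
  define D where "D = c1 - c2"
  have D: "D > 0" and s: "s > 0" using assms by (auto simp: D_def s_def)
  \<comment> \<open>Completing the square at \<open>\<beta> = 1/4\<close>, where
    \<open>s * \<beta>\<close> is largest.\<close>
  have "8 * s * \<beta> = 1 - (1 - 4 * \<beta>)\<^sup>2"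
    by (simp add: s_def power2_eq_square algebra_simps)
  then have sb: "8 * s * \<beta> \<le> 1" by simp
  have "16 * L * A * e * c2 \<le> 8 * s\<^sup>2 * c2"
    using e assms unfolding s_def
    by (simp add: mult_ac)
  also have "\<dots> \<le> 8 * s\<^sup>2 * (\<beta> * D)"
    using c2 by (intro mult_left_mono) (auto simp: D_def)
  also have "\<dots> = (8 * s * \<beta>) * (s * D)"
    by (simp add: power2_eq_square)
  also have "\<dots> \<le> 1 * (s * D)"
    using sb s D by (intro mult_right_mono) auto
  finally have 1: "16 * L * A * e * c2 \<le> s * D" by simp
  \<comment> \<open>AM-GM in the form
    \<open>(a + b)\<^sup>2 = (a - b)\<^sup>2 + 4 * a * b\<close>.\<close>
  have "(c2 + s * D / 8)\<^sup>2 = (c2 - s * D / 8)\<^sup>2 + c2 * (s * D) / 2"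
    by (simp add: power2_eq_square algebra_simps)
  then have "(c2 + s * D / 8)\<^sup>2 \<ge> c2 * (s * D) / 2" by simp
  moreover have "c2 * (s * D) / 2 \<ge> c2 * (16 * L * A * e * c2) / 2"
    using 1 assms by (intro divide_right_mono mult_left_mono) auto
  ultimately have "8 * L * A * e * c2\<^sup>2 \<le> (c2 + s * D / 8)\<^sup>2"
    by (simp add: power2_eq_square mult_ac)
  then have "8 * L * A * e * c2\<^sup>2 / (2 * (A * e\<^sup>2 * c2\<^sup>2)) \<le> (c2 + s * D / 8)\<^sup>2 / (2 * (A * e\<^sup>2 * c2\<^sup>2))"
    using assms by (intro divide_right_mono) auto
  moreover have "8 * L * A * e * c2\<^sup>2 / (2 * (A * e\<^sup>2 * c2\<^sup>2)) = 4 * L / e"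
    using assms by (simp add: field_simps power2_eq_square)
  ultimately show ?thesis by (simp add: s_def D_def)
qed

text \<open>The exponential is split into two equal halves: one pays for the union over
  \<open>K\<close> atoms through \<open>ln (2*K) \<le> L\<close>, the other yields the factor
  \<open>e\<^sup>2\<close> through \<open>4/3 \<le> L\<close>.\<close>

lemma tail_total_le:
  fixes K e L :: real
  assumes "0 < K" "0 < e" "e \<le> 1" "ln (2*K) \<le> L" "4/3 \<le> L"
  shows "2 * exp 1 * K * exp (- (4 * L / e)) \<le> e\<^sup>2 / (2 * K)"
proof -
  have "exp (- (2 * L / e)) \<le> exp (- (2 * L))"
    using assms by (simp add: field_simps)
  also have "\<dots> \<le> exp (- (2 * ln (2 * K)))"
    using assms by simp
  also have "\<dots> = 1 / (4 * K\<^sup>2)"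
    using assms by (simp add: exp_minus exp_double power2_eq_square field_simps)
  finally have 1: "exp (- (2 * L / e)) \<le> 1 / (4 * K\<^sup>2)" .
  \<comment> \<open>This is \<open>2 * L / e\<close> at the smallest admissible value
    \<open>L = 4/3\<close>.\<close>
  define t where "t = 8 / (3 * e)"
  have t: "t > 0" using assms by (simp add: t_def)
  have "t \<le> 2 * L / e" using assms by (simp add: t_def field_simps)
  then have "exp (- (2 * L / e)) \<le> exp (- t)" by simp
  also have "\<dots> \<le> 1 / (t\<^sup>2 / 2)"
    unfolding exp_minus inverse_eq_divide
    using exp_lower_Taylor_quadratic[of t] t
    by (intro divide_left_mono) auto
  also have "\<dots> = 9/32 * e\<^sup>2"
    using assms by (simp add: t_def power2_eq_square field_simps)
  finally have 2: "exp (- (2 * L / e)) \<le> 9/32 * e\<^sup>2" .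
  have "exp (- (4 * L / e)) = exp (- (2 * L / e)) * exp (- (2 * L / e))"
    by (simp flip: exp_add add: field_simps)
  also have "\<dots> \<le> 1 / (4 * K\<^sup>2) * (9/32 * e\<^sup>2)"
    using 1 2 by (intro mult_mono) auto
  finally have "2 * exp 1 * K * exp (- (4 * L / e)) \<le> 2 * 3 * K * (1 / (4 * K\<^sup>2) * (9/32 * e\<^sup>2))"
    using exp_le assms by (intro mult_mono) auto
  \<comment> \<open>The constants multiply to 27/64, which is below 1/2.\<close>
  also have "\<dots> \<le> e\<^sup>2 / (2 * K)"
    using assms by (simp add: power2_eq_square field_simps)
  finally show ?thesis .
qed

section \<open>Loss from a wrongly selected atom\<close>

lemma synth_flip: "h \<bullet> synth \<Phi> (flip s x) = (\<Sum>j\<in>UNIV. s j * (x$j * (h \<bullet> \<Phi> j)))"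
  by (simp add: synth_def inner_sum_right mult_ac)

lemma analysis_linf_sq_ge: "(\<Psi> i \<bullet> y)\<^sup>2 \<le> analysis_linf_sq \<Psi> y"
proof -
  have "\<bar>\<Psi> i \<bullet> y\<bar> \<le> Max (range (\<lambda>i. \<bar>\<Psi> i \<bullet> y\<bar>))"
    by (intro Max_ge) auto
  then show ?thesis
    unfolding analysis_linf_sq_def by (metis abs_ge_zero power2_abs power_mono)
qed

lemma analysis_linf_sq_attained: "\<exists>k. analysis_linf_sq \<Psi> y = (\<Psi> k \<bullet> y)\<^sup>2"
proof -
  have "Max (range (\<lambda>i. \<bar>\<Psi> i \<bullet> y\<bar>)) \<in> range (\<lambda>i. \<bar>\<Psi> i \<bullet> y\<bar>)"
    by (intro Max_in) auto
  then obtain k where "Max (range (\<lambda>i. \<bar>\<Psi> i \<bullet> y\<bar>)) = \<bar>\<Psi> k \<bullet> y\<bar>" by blast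
  then show ?thesis
    unfolding analysis_linf_sq_def by (intro exI[of _ k]) simp
qed

text \<open>Puts the growth of a squared response into exponential form, so that the moment
  generating function of the signs controls it.\<close>

lemma sq_sum_le_exp:
  fixes a u :: real
  assumes "0 < a" "0 \<le> u"
  shows "(a + u)\<^sup>2 \<le> a\<^sup>2 * exp (2 * u / a)"
proof -
  have "(1 + u / a)\<^sup>2 \<le> (exp (u / a))\<^sup>2"
    using assms by (intro power_mono exp_ge_add_one_self_aux) auto
  also have "\<dots> = exp (2 * u / a)"
    by (simp add: exp_double[symmetric])
  finally have "a\<^sup>2 * (1 + u / a)\<^sup>2 \<le> a\<^sup>2 * exp (2 * u / a)"
    by (intro mult_left_mono) auto
  moreover have "a\<^sup>2 * (1 + u / a)\<^sup>2 = (a + u)\<^sup>2"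
    using assms by (simp add: field_simps flip: power_mult_distrib)
  ultimately show ?thesis by simp
qed

section \<open>Fixed coefficients and noise, random signs on the coefficients\<close>

context
  fixes \<Phi> \<Psi> :: "'k::finite \<Rightarrow> real^'d"
    and x :: "real^'k" and r :: "real^'d" and i :: 'k
    and A \<mu> \<rho> \<beta> e c2 L :: real
  assumes \<Phi>: "\<Phi> \<in> dictionary"
    and frame: "\<And>v. (\<Sum>i\<in>UNIV. (\<Phi> i \<bullet> v)\<^sup>2) = A * (norm v)\<^sup>2"
    and \<mu>: "\<And>j k. j \<noteq> k \<Longrightarrow> \<bar>\<Phi> j \<bullet> \<Phi> k\<bar> \<le> \<mu>" "0 \<le> \<mu>"
    and e: "\<And>k. norm (\<Psi> k - \<Phi> k) \<le> e" "0 < e" "e \<le> 1/5"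
    and eL: "e * (2 * A * L) \<le> (1 - 2*\<beta>)\<^sup>2"
    and L: "ln (2 * real CARD('k)) \<le> L" "4/3 \<le> L"
    and A1: "1 \<le> A"
    and \<beta>: "\<beta> < 1/2"
    and c2: "\<And>j. j \<noteq> i \<Longrightarrow> \<bar>x$j\<bar> \<le> c2" "0 \<le> c2" "c2 < \<bar>x$i\<bar>"
    and gap: "c2 + \<mu> * (\<Sum>j\<in>UNIV. \<bar>x$j\<bar>) + \<rho> \<le> \<beta> * (\<bar>x$i\<bar> - c2)"
    and r: "norm r \<le> \<rho>"
begin

private definition "c1 = \<bar>x$i\<bar>"
text \<open>If the random sums of atom \<open>i\<close> and of a rival stay within this threshold,
  the rival cannot win.\<close>

private definition "m = c2 + (1 - 2*\<beta>) * (c1 - c2) / 8"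
text \<open>The random part of \<open>(\<Psi> k - \<Phi> k) \<bullet> y s\<close>. The dominant
  index is left out, so that every weight carries a coefficient of size at most \<open>c2\<close>;
  its contribution is bounded deterministically.\<close>

private definition "w k s = (\<Sum>j\<in>UNIV. s j * (if j = i then 0 else x$j * ((\<Psi> k - \<Phi> k) \<bullet> \<Phi> j)))"
private definition "y s = synth \<Phi> (flip s x) + r"
text \<open>Deterministic part of the bound for the response of a wrong atom: its own coefficient,
  crosstalk, noise, and perturbation of the atom.\<close>

private definition "P = c2 + \<mu> * (\<Sum>j\<in>UNIV. \<bar>x$j\<bar>) + \<rho> + e * (c1 + \<rho>)"

private lemma c1: "0 \<le> c2" "c2 < c1" "0 < c1"
  using c2 by (auto simp: c1_def)

private lemma \<rho>: "0 \<le> \<rho>"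
  using r norm_ge_zero order_trans by blast

private lemma \<mu>x: "0 \<le> \<mu> * (\<Sum>j\<in>UNIV. \<bar>x$j\<bar>)"
  using \<mu> by (intro mult_nonneg_nonneg sum_nonneg) auto

private lemma gap': "c2 + \<mu> * (\<Sum>j\<in>UNIV. \<bar>x$j\<bar>) + \<rho> \<le> \<beta> * (c1 - c2)"
  using gap by (simp add: c1_def)

private lemma \<beta>0: "0 \<le> \<beta>"
proof -
  have "0 \<le> \<beta> * (c1 - c2)" using gap' \<rho> \<mu>x c1 by linarith
  then show ?thesis using c1 by (simp add: zero_le_mult_iff)
qed

private lemma margin: "P + m \<le> c1 - \<mu> * (\<Sum>j\<in>UNIV. \<bar>x$j\<bar>) - \<rho> - e * (c1 + \<rho>) - m"
proof -
  have "e * (8/3) \<le> e * (2 * A * L)"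
  proof (intro mult_left_mono)
    \<comment> \<open>This is where the constant 8/3 of \<open>margin_le\<close> comes from.\<close>
    have "1 * (4/3) \<le> A * L" using A1 L by (intro mult_mono) auto
    then show "8/3 \<le> 2 * A * L" by simp
  qed (use e in auto)
  with eL have "e * (8/3) \<le> (1 - 2*\<beta>)\<^sup>2" by linarith
  from margin_le[OF c1(1,2) \<rho> _ \<beta> \<mu>x gap' this] e show ?thesis
    by (simp add: P_def m_def)
qed

text \<open>\<open>P_le\<close> bounds a wrong response by \<open>c1\<close> plus a random sum;
  \<open>m_le\<close> makes \<open>2 * m / c1\<close> at most 1, so that the tail bound loses only a
  factor \<open>exp 1\<close>.\<close>

private lemma m_le: "m \<le> c1 / 2" and P_le: "P \<le> c1" and m0: "0 \<le> m"
proof -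
  have "c2 \<le> \<beta> * (c1 - c2)" using gap' \<rho> \<mu>x by linarith
  then have "m \<le> (\<beta> + (1 - 2*\<beta>)/8) * (c1 - c2)"
    by (simp add: m_def algebra_simps add_divide_distrib diff_divide_distrib)
  also have "\<dots> \<le> 1/2 * (c1 - c2)"
    using \<beta> c1 by (intro mult_right_mono) (auto simp: field_simps)
  finally show "m \<le> c1 / 2" using c1 by simp
  have "\<beta> * (c1 - c2) \<le> 1/2 * (c1 - c2)" using \<beta> c1 by (intro mult_right_mono) auto
  moreover have "\<beta> * (c1 - c2) \<ge> \<rho>" using gap' \<mu>x c1 by linarith
  moreover have "e * (c1 + \<rho>) \<le> 1/5 * (c1 + \<rho>)" using e c1 \<rho> by (intro mult_right_mono) auto
  ultimately show "P \<le> c1" using gap' c1 unfolding P_def by (simp add: algebra_simps)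
  show "0 \<le> m" using c1 \<beta> by (auto simp: m_def)
qed

text \<open>By Cauchy-Schwarz the dominant coefficient contributes at most \<open>c1 * e\<close> and
  the noise at most \<open>e * \<rho>\<close>; only the small coefficients remain as a random
  sum.\<close>

private lemma inner_diff_le:
  assumes s: "s \<in> signs"
  shows "\<bar>(\<Psi> k - \<Phi> k) \<bullet> y s\<bar> \<le> e * (c1 + \<rho>) + \<bar>w k s\<bar>"
proof -
  let ?h = "\<Psi> k - \<Phi> k"
  have "?h \<bullet> y s = (\<Sum>j\<in>UNIV. s j * (x$j * (?h \<bullet> \<Phi> j))) + ?h \<bullet> r"
    by (simp only: y_def inner_add_right synth_flip)
  also have "(\<Sum>j\<in>UNIV. s j * (x$j * (?h \<bullet> \<Phi> j)))
      = (\<Sum>j\<in>UNIV. (if j = i then s i * x$i * (?h \<bullet> \<Phi> i) else 0)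
          + s j * (if j = i then 0 else x$j * (?h \<bullet> \<Phi> j)))"
    by (intro sum.cong refl) auto
  also have "\<dots> = s i * x$i * (?h \<bullet> \<Phi> i) + w k s"
    by (simp add: sum.distrib w_def)
  finally have eq: "?h \<bullet> y s = s i * x$i * (?h \<bullet> \<Phi> i) + w k s + ?h \<bullet> r" .
  have "\<bar>?h \<bullet> \<Phi> i\<bar> \<le> norm ?h * norm (\<Phi> i)" by (rule Cauchy_Schwarz_ineq2)
  also have "\<dots> \<le> e" using e(1)[of k] \<Phi> by (simp add: dictionary_def)
  finally have "\<bar>s i * x$i * (?h \<bullet> \<Phi> i)\<bar> \<le> c1 * e"
    using s by (simp add: abs_mult signsD c1_def mult_left_mono)
  moreover have "\<bar>?h \<bullet> r\<bar> \<le> e * \<rho>"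
    using Cauchy_Schwarz_ineq2[of ?h r] mult_mono[OF e(1)[of k] r] e by auto
  ultimately show ?thesis
    unfolding eq by (simp add: algebra_simps)
qed

private lemma inner_atom:
  assumes s: "s \<in> signs"
  shows "\<bar>\<Phi> k \<bullet> y s - s k * x$k\<bar> \<le> \<mu> * (\<Sum>j\<in>UNIV. \<bar>x$j\<bar>) + \<rho>"
proof -
  have nk: "\<Phi> k \<bullet> \<Phi> k = 1" using \<Phi> by (simp add: dictionary_def dot_square_norm)
  have "\<Phi> k \<bullet> y s = (\<Sum>j\<in>UNIV. s j * (x$j * (\<Phi> k \<bullet> \<Phi> j))) + \<Phi> k \<bullet> r"
    by (simp only: y_def inner_add_right synth_flip)
  also have "(\<Sum>j\<in>UNIV. s j * (x$j * (\<Phi> k \<bullet> \<Phi> j)))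
      = s k * x$k + (\<Sum>j\<in>UNIV-{k}. s j * (x$j * (\<Phi> k \<bullet> \<Phi> j)))"
    by (subst sum.remove[of _ k]) (auto simp: nk)
  finally have eq: "\<Phi> k \<bullet> y s - s k * x$k = (\<Sum>j\<in>UNIV-{k}. s j * (x$j * (\<Phi> k \<bullet> \<Phi> j))) + \<Phi> k \<bullet> r"
    by simp
  have "\<bar>\<Sum>j\<in>UNIV-{k}. s j * (x$j * (\<Phi> k \<bullet> \<Phi> j))\<bar> \<le> (\<Sum>j\<in>UNIV-{k}. \<bar>s j * (x$j * (\<Phi> k \<bullet> \<Phi> j))\<bar>)"
    by (rule sum_abs)
  also have "\<dots> \<le> (\<Sum>j\<in>UNIV-{k}. \<mu> * \<bar>x$j\<bar>)"
  proof (intro sum_mono)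
    fix j assume "j \<in> UNIV - {k}"
    then have "\<bar>x$j\<bar> * \<bar>\<Phi> k \<bullet> \<Phi> j\<bar> \<le> \<bar>x$j\<bar> * \<mu>" by (intro mult_left_mono \<mu>) auto
    then show "\<bar>s j * (x$j * (\<Phi> k \<bullet> \<Phi> j))\<bar> \<le> \<mu> * \<bar>x$j\<bar>"
      using s by (simp add: abs_mult signsD mult_ac)
  qed
  also have "\<dots> \<le> (\<Sum>j\<in>UNIV. \<mu> * \<bar>x$j\<bar>)"
    using \<mu> by (intro sum_mono2) auto
  finally have 1: "\<bar>\<Sum>j\<in>UNIV-{k}. s j * (x$j * (\<Phi> k \<bullet> \<Phi> j))\<bar> \<le> \<mu> * (\<Sum>j\<in>UNIV. \<bar>x$j\<bar>)"
    by (simp add: sum_distrib_left)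
  have "\<bar>\<Phi> k \<bullet> r\<bar> \<le> \<rho>"
    using Cauchy_Schwarz_ineq2[of "\<Phi> k" r] \<Phi> r by (simp add: dictionary_def)
  with 1 show ?thesis unfolding eq by linarith
qed

private lemma upper:
  assumes s: "s \<in> signs" and k: "k \<noteq> i"
  shows "\<bar>\<Psi> k \<bullet> y s\<bar> \<le> P + \<bar>w k s\<bar>"
proof -
  have "\<bar>s k * x$k\<bar> \<le> c2" using s k c2 by (simp add: abs_mult signsD)
  moreover have "\<Psi> k \<bullet> y s = \<Phi> k \<bullet> y s + (\<Psi> k - \<Phi> k) \<bullet> y s" by (simp add: inner_diff_left)
  ultimately show ?thesis
    using inner_diff_le[OF s, of k] inner_atom[OF s, of k] unfolding P_def by linarith
qed

private lemma lower:
  assumes s: "s \<in> signs"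
  shows "\<bar>\<Psi> i \<bullet> y s\<bar> \<ge> P + 2 * m - \<bar>w i s\<bar>"
proof -
  have "\<bar>s i * x$i\<bar> = c1" using s by (simp add: abs_mult signsD c1_def)
  moreover have "\<Psi> i \<bullet> y s = \<Phi> i \<bullet> y s + (\<Psi> i - \<Phi> i) \<bullet> y s" by (simp add: inner_diff_left)
  ultimately show ?thesis
    using inner_diff_le[OF s, of i] inner_atom[OF s, of i] margin by linarith
qed

text \<open>When both random sums are at most \<open>m\<close>, a rival reaches at most
  \<open>P + m\<close>, while \<open>lower\<close> guarantees atom \<open>i\<close> at least that
  much.\<close>

private lemma excess_cases:
  assumes s: "s \<in> signs"
  shows "analysis_linf_sq \<Psi> (y s) \<le> (\<Psi> i \<bullet> y s)\<^sup>2 \<or>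
    (\<exists>l. m < \<bar>w l s\<bar> \<and> analysis_linf_sq \<Psi> (y s) \<le> (c1 + \<bar>w l s\<bar>)\<^sup>2)"
proof -
  obtain k where k: "analysis_linf_sq \<Psi> (y s) = (\<Psi> k \<bullet> y s)\<^sup>2"
    using analysis_linf_sq_attained by blast
  show ?thesis
  proof (cases "k = i \<or> (\<bar>w k s\<bar> \<le> m \<and> \<bar>w i s\<bar> \<le> m)")
    case True
    then have "\<bar>\<Psi> k \<bullet> y s\<bar> \<le> \<bar>\<Psi> i \<bullet> y s\<bar>"
      using upper[OF s, of k] lower[OF s] by (cases "k = i") auto
    then show ?thesis unfolding k by (simp add: abs_le_square_iff)
  next
    case False
    \<comment> \<open>\<open>l\<close> is \<open>k\<close> if its sum exceeds \<open>m\<close>, and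
      \<open>i\<close> otherwise.\<close>
    then obtain l where l: "m < \<bar>w l s\<bar>" "\<bar>w k s\<bar> \<le> \<bar>w l s\<bar>"
      by (metis linorder_le_cases linorder_not_le order.strict_trans2)
    have "\<bar>\<Psi> k \<bullet> y s\<bar> \<le> c1 + \<bar>w l s\<bar>"
      using upper[OF s, of k] P_le l False by auto
    then have "(\<Psi> k \<bullet> y s)\<^sup>2 \<le> (c1 + \<bar>w l s\<bar>)\<^sup>2"
      by (metis abs_ge_zero power2_abs power_mono)
    then show ?thesis using l k by auto
  qed
qed

text \<open>Bounding the small coefficients by \<open>c2\<close> leaves the frame coefficients of
  \<open>\<Psi> k - \<Phi> k\<close>, whose energy the tight frame identity evaluates.\<close>

private lemma w_variance:
  "(\<Sum>j\<in>UNIV. (if j = i then 0 else x$j * ((\<Psi> k - \<Phi> k) \<bullet> \<Phi> j))\<^sup>2) \<le> A * e\<^sup>2 * c2\<^sup>2"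
proof -
  let ?h = "\<Psi> k - \<Phi> k"
  have "(\<Sum>j\<in>UNIV. (if j = i then 0 else x$j * (?h \<bullet> \<Phi> j))\<^sup>2) \<le> (\<Sum>j\<in>UNIV. c2\<^sup>2 * (\<Phi> j \<bullet> ?h)\<^sup>2)"
  proof (intro sum_mono)
    fix j
    have "(x$j)\<^sup>2 \<le> c2\<^sup>2" if "j \<noteq> i"
      using c2(1)[OF that] by (metis abs_ge_zero power2_abs power_mono)
    then show "(if j = i then 0 else x$j * (?h \<bullet> \<Phi> j))\<^sup>2 \<le> c2\<^sup>2 * (\<Phi> j \<bullet> ?h)\<^sup>2"
      by (auto simp: power_mult_distrib inner_commute intro: mult_right_mono)
  qed
  also have "\<dots> = c2\<^sup>2 * (A * (norm ?h)\<^sup>2)"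
    by (simp only: sum_distrib_left[symmetric] frame)
  also have "\<dots> \<le> c2\<^sup>2 * (A * e\<^sup>2)"
    using e(1)[of k] A1 by (intro mult_left_mono power_mono) auto
  finally show ?thesis by (simp add: mult_ac)
qed

text \<open>A Chernoff bound with a union over the atoms: when atom \<open>i\<close> loses, the
  squared response is dominated by an exponential of one random sum, whose sign average is
  sub-Gaussian.\<close>

lemma sum_signs_analysis_le:
  "(\<Sum>s\<in>signs. analysis_linf_sq \<Psi> (synth \<Phi> (flip s x) + r))
   \<le> (\<Sum>s\<in>signs. (\<Psi> i \<bullet> (synth \<Phi> (flip s x) + r))\<^sup>2)
     + real (card (signs :: ('k \<Rightarrow> real) set)) * ((x$i)\<^sup>2 * (e\<^sup>2 / (2 * real CARD('k))))"
proof -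
  let ?N = "real (card (signs :: ('k \<Rightarrow> real) set))"
  let ?v = "A * e\<^sup>2 * c2\<^sup>2"
  have "(\<Sum>s\<in>signs. analysis_linf_sq \<Psi> (y s))
    \<le> (\<Sum>s\<in>signs. (\<Psi> i \<bullet> y s)\<^sup>2) + ?N * (c1\<^sup>2 * (e\<^sup>2 / (2 * real CARD('k))))"
  proof (cases "c2 = 0")
    \<comment> \<open>Here the variance bound \<open>?v\<close> is 0 and cannot serve as the
      denominator of \<open>t\<close>, but all random sums vanish.\<close>
    case True
    have w0: "w l s = 0" for l s
    proof -
      have "x$j = 0" if "j \<noteq> i" for j using c2(1)[OF that] True by simp
      then show ?thesis unfolding w_def by (intro sum.neutral) auto
    qed
    have "(\<Sum>s\<in>signs. analysis_linf_sq \<Psi> (y s)) \<le> (\<Sum>s\<in>signs. (\<Psi> i \<bullet> y s)\<^sup>2)"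
      using excess_cases m0 by (intro sum_mono) (fastforce simp: w0)
    moreover have "0 \<le> ?N * (c1\<^sup>2 * (e\<^sup>2 / (2 * real CARD('k))))" by simp
    ultimately show ?thesis by linarith
  next
    case False
    then have c20: "0 < c2" using c2 by simp
    have v: "0 < ?v" using c20 e A1 by simp
    \<comment> \<open>The minimiser of \<open>- (t * m) + t\<^sup>2 * ?v / 2\<close>; the minimum is
      \<open>- (m\<^sup>2 / (2 * ?v))\<close>.\<close>
    define t where "t = m / ?v"
    have c2\<beta>: "c2 \<le> \<beta> * (c1 - c2)" using gap' \<rho> \<mu>x by linarith
    have exponent: "4 * L / e \<le> m\<^sup>2 / (2 * ?v)"
      unfolding m_def using tail_exponent_ge[OF c20 c1(2) e(2) \<beta> _ c2\<beta> eL] A1 by simp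
    have mpos: "0 < m" using c20 \<beta> c1 by (simp add: m_def add_pos_pos)
    \<comment> \<open>\<open>m * t = m\<^sup>2 / ?v\<close> is at least 8 while
      \<open>m * (2 / c1)\<close> is at most 1, so the Chernoff rate \<open>t\<close> exceeds the
      growth rate \<open>2 / c1\<close> of the squared response.\<close>
    have "4 * 1 \<le> 4 * L / e" using L e by (simp add: field_simps)
    then have "4 \<le> m\<^sup>2 / (2 * ?v)" using exponent by linarith
    then have "8 \<le> m * t" by (simp add: t_def power2_eq_square field_simps)
    moreover have "m * (2 / c1) \<le> 1" using m_le c1 by (simp add: field_simps)
    ultimately have "m * (2 / c1) \<le> m * t" by linarith
    then have tc: "2 / c1 \<le> t" using mpos by (rule mult_left_le_imp_le)
    have pt: "analysis_linf_sq \<Psi> (y s) \<le> (\<Psi> i \<bullet> y s)\<^sup>2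
        + (\<Sum>l\<in>UNIV. c1\<^sup>2 * exp (1 - t * m) * exp (t * \<bar>w l s\<bar>))" if s: "s \<in> signs" for s
      using excess_cases[OF s]
    proof (elim disjE exE conjE)
      assume "analysis_linf_sq \<Psi> (y s) \<le> (\<Psi> i \<bullet> y s)\<^sup>2"
      moreover have "0 \<le> (\<Sum>l\<in>UNIV. c1\<^sup>2 * exp (1 - t * m) * exp (t * \<bar>w l s\<bar>))"
        by (intro sum_nonneg) auto
      ultimately show ?thesis by linarith
    next
      fix l assume l: "m < \<bar>w l s\<bar>" "analysis_linf_sq \<Psi> (y s) \<le> (c1 + \<bar>w l s\<bar>)\<^sup>2"
      have "(c1 + \<bar>w l s\<bar>)\<^sup>2 \<le> c1\<^sup>2 * exp (2 * \<bar>w l s\<bar> / c1)"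
        by (rule sq_sum_le_exp) (use c1 in auto)
      also have "\<dots> \<le> c1\<^sup>2 * exp (1 - t * m + t * \<bar>w l s\<bar>)"
      proof -
        \<comment> \<open>Both exponents are affine in \<open>\<bar>w l s\<bar>\<close> and
          \<open>t\<close> is the larger slope, so it suffices to compare them at \<open>m\<close>,
          where the claim is \<open>2 * m / c1 \<le> 1\<close>.\<close>
        have "0 \<le> (t - 2 / c1) * (\<bar>w l s\<bar> - m)" using tc l by (intro mult_nonneg_nonneg) auto
        then have "2 * \<bar>w l s\<bar> / c1 \<le> 1 - t * m + t * \<bar>w l s\<bar>"
          using \<open>m * (2 / c1) \<le> 1\<close> by (simp add: algebra_simps)
        then show ?thesis by (intro mult_left_mono) auto
      qed
      also have "\<dots> = c1\<^sup>2 * exp (1 - t * m) * exp (t * \<bar>w l s\<bar>)"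
        by (simp add: exp_add)
      also have "\<dots> \<le> (\<Sum>l\<in>UNIV. c1\<^sup>2 * exp (1 - t * m) * exp (t * \<bar>w l s\<bar>))"
        by (rule member_le_sum) auto
      finally show ?thesis using l(2) zero_le_power2[of "\<Psi> i \<bullet> y s"] by linarith
    qed
    have "(\<Sum>s\<in>signs. \<Sum>l\<in>UNIV. c1\<^sup>2 * exp (1 - t * m) * exp (t * \<bar>w l s\<bar>))
        = (\<Sum>l\<in>UNIV. c1\<^sup>2 * exp (1 - t * m) * (\<Sum>s\<in>signs. exp (t * \<bar>w l s\<bar>)))"
      by (subst sum.swap) (simp add: sum_distrib_left)
    also have "\<dots> \<le> (\<Sum>l\<in>(UNIV::'k set). c1\<^sup>2 * exp (1 - t * m) * (2 * ?N * exp (t\<^sup>2 * ?v / 2)))"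
      unfolding w_def by (intro sum_mono mult_left_mono sum_signs_exp_abs_le w_variance) auto
    also have "\<dots> = ?N * (c1\<^sup>2 * (2 * exp 1 * real CARD('k) * exp (- (t * m) + t\<^sup>2 * ?v / 2)))"
    proof -
      have "exp (1 - t * m) * exp (t\<^sup>2 * ?v / 2) = exp 1 * exp (- (t * m) + t\<^sup>2 * ?v / 2)"
        by (simp only: mult_exp_exp) simp
      then show ?thesis by (simp only: sum_constant mult_ac)
    qed
    also have "- (t * m) + t\<^sup>2 * ?v / 2 = - (m\<^sup>2 / (2 * ?v))"
      using v by (simp add: t_def power2_eq_square field_simps)
    also have "?N * (c1\<^sup>2 * (2 * exp 1 * real CARD('k) * exp (- (m\<^sup>2 / (2 * ?v)))))
        \<le> ?N * (c1\<^sup>2 * (2 * exp 1 * real CARD('k) * exp (- (4 * L / e))))"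
      using exponent by (intro mult_left_mono) auto
    also have "\<dots> \<le> ?N * (c1\<^sup>2 * (e\<^sup>2 / (2 * real CARD('k))))"
      using e L by (intro mult_left_mono tail_total_le) auto
    finally have "(\<Sum>s\<in>signs. \<Sum>l\<in>UNIV. c1\<^sup>2 * exp (1 - t * m) * exp (t * \<bar>w l s\<bar>))
      \<le> ?N * (c1\<^sup>2 * (e\<^sup>2 / (2 * real CARD('k))))" .
    moreover have "(\<Sum>s\<in>signs. analysis_linf_sq \<Psi> (y s)) \<le> (\<Sum>s\<in>signs. (\<Psi> i \<bullet> y s)\<^sup>2)
        + (\<Sum>s\<in>signs. \<Sum>l\<in>UNIV. c1\<^sup>2 * exp (1 - t * m) * exp (t * \<bar>w l s\<bar>))"
      unfolding sum.distrib[symmetric] by (intro sum_mono pt)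
    ultimately show ?thesis by linarith
  qed
  then show ?thesis by (simp add: y_def c1_def)
qed

end

section \<open>Symmetric coefficients and centred noise\<close>

text \<open>Strict inequality makes these sets disjoint; vectors with a tie for the maximum lie in
  none of them.\<close>

definition dominant :: "'k::finite \<Rightarrow> (real^'k) set" where
  "dominant i = {x. \<forall>j. j \<noteq> i \<longrightarrow> \<bar>x$j\<bar> < \<bar>x$i\<bar>}"

lemma dominant_unique: "x \<in> dominant i \<Longrightarrow> x \<in> dominant k \<Longrightarrow> i = k"
  by (force simp: dominant_def)

text \<open>Turns evaluation at the dominant index, which depends on \<open>x\<close>, into a sum of
  indicators that can be integrated term by term.\<close>

lemma sum_dominant:
  fixes f :: "'k::finite \<Rightarrow> real"
  assumes "x \<in> dominant i"
  shows "(\<Sum>k\<in>UNIV. indicator (dominant k) x * f k) = f i"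
proof -
  have "indicator (dominant k) x = (if k = i then 1 else 0 :: real)" for k
    using assms dominant_unique[of x k i] by (cases "k = i") (auto simp: indicator_def)
  then show ?thesis by (simp add: if_distrib[of "\<lambda>u. u * _"] cong: if_cong)
qed

lemma linf_norm_dominant:
  assumes "x \<in> dominant i"
  shows "linf_norm x = \<bar>x$i\<bar>"
  unfolding linf_norm_def
  by (rule Max_eqI) (use assms in \<open>auto simp: dominant_def intro: less_imp_le\<close>)

lemma dominant_permute:
  assumes "bij p"
  shows "(\<chi> i. x$(p i)) \<in> dominant i \<longleftrightarrow> x \<in> dominant (p i)"
proof -
  have "(\<forall>j. j \<noteq> i \<longrightarrow> \<bar>x $ p j\<bar> < \<bar>x $ p i\<bar>) \<longleftrightarrow> (\<forall>j. j \<noteq> p i \<longrightarrow> \<bar>x $ j\<bar> < \<bar>x $ p i\<bar>)"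
    using assms by (metis bij_pointE)
  then show ?thesis by (simp add: dominant_def)
qed

lemma dominant_borel [measurable]: "dominant i \<in> sets borel"
proof -
  have "dominant i = {x\<in>space borel. \<forall>j\<in>UNIV. j \<noteq> i \<longrightarrow> \<bar>x$j\<bar> < \<bar>x$i\<bar>}"
    by (auto simp: dominant_def)
  also have "\<dots> \<in> sets borel" by measurable
  finally show ?thesis .
qed

lemma norm_vec_sq: "(norm (x::real^'k::finite))\<^sup>2 = (\<Sum>j\<in>UNIV. (x$j)\<^sup>2)"
  by (simp only: power2_norm_eq_inner inner_vec_def) (simp add: power2_eq_square)

lemma analysis_linf_sq_le:
  assumes "\<Psi> \<in> dictionary"
  shows "analysis_linf_sq \<Psi> y \<le> (norm y)\<^sup>2"
proof -
  obtain k where k: "analysis_linf_sq \<Psi> y = (\<Psi> k \<bullet> y)\<^sup>2"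
    using analysis_linf_sq_attained by blast
  have "\<bar>\<Psi> k \<bullet> y\<bar> \<le> norm y"
    using Cauchy_Schwarz_ineq2[of "\<Psi> k" y] assms by (simp add: dictionary_def)
  then show ?thesis unfolding k by (metis abs_ge_zero power2_abs power_mono)
qed

lemma analysis_linf_sq_nonneg: "0 \<le> analysis_linf_sq \<Psi> y"
  by (simp add: analysis_linf_sq_def)

lemma analysis_linf_sq_borel [measurable]: "analysis_linf_sq \<Psi> \<in> borel_measurable borel"
  unfolding analysis_linf_sq_def[abs_def] by (intro borel_measurable_power borel_measurable_Max) auto

lemma linf_norm_borel [measurable]: "linf_norm \<in> borel_measurable borel"
  unfolding linf_norm_def[abs_def] by (intro borel_measurable_Max) auto

lemma continuous_synth: "continuous_on UNIV (synth \<Phi>)"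
  unfolding synth_def[abs_def] by (intro continuous_intros)

lemma synth_borel [measurable]: "synth \<Phi> \<in> borel_measurable borel"
  by (intro borel_measurable_continuous_onI continuous_synth)

lemma norm_synth_le:
  fixes \<Phi> :: "'k::finite \<Rightarrow> real^'d"
  assumes "\<Phi> \<in> dictionary" "norm x = 1"
  shows "norm (synth \<Phi> x) \<le> real CARD('k)"
proof -
  have "norm (synth \<Phi> x) \<le> (\<Sum>i\<in>UNIV. norm (x$i *\<^sub>R \<Phi> i))"
    unfolding synth_def by (rule norm_sum)
  also have "\<dots> \<le> (\<Sum>i\<in>(UNIV::'k set). 1)"
    using assms component_le_norm_cart[of x] by (intro sum_mono) (auto simp: dictionary_def)
  finally show ?thesis by simp
qed

lemma flip_borel [measurable]: "flip s \<in> borel_measurable borel"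
proof -
  have "continuous_on UNIV (flip s)"
    unfolding flip_def[abs_def] by (intro continuous_intros)
  then show ?thesis by (rule borel_measurable_continuous_onI)
qed

lemma permute_borel [measurable]: "(\<lambda>x::real^'k::finite. \<chi> i. x$(p i)) \<in> borel_measurable borel"
proof -
  have "continuous_on UNIV (\<lambda>x::real^'k. \<chi> i. x$(p i))"
    by (intro continuous_intros)
  then show ?thesis by (rule borel_measurable_continuous_onI)
qed

section \<open>Moments of bounded, centred, isotropic noise\<close>

context
  fixes R :: "(real^'d) measure" and \<rho> \<rho>max :: real
  assumes R_prob: "prob_space R" and R_sets [measurable_cong]: "sets R = sets borel"
    and R_bdd: "AE r in R. norm r \<le> \<rho>max"
    and R_mean: "integral\<^sup>L R (\<lambda>r. r) = 0"
    and R_cov: "\<forall>i j. integral\<^sup>L R (\<lambda>r. r$i * r$j) = (if i = j then \<rho>^2 else 0)"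
begin

interpretation R: prob_space R by (rule R_prob)

lemma noise_integrable:
  fixes f :: "real^'d \<Rightarrow> 'b::{banach, second_countable_topology}"
  assumes "f \<in> borel_measurable borel" "\<And>r. norm r \<le> \<rho>max \<Longrightarrow> norm (f r) \<le> B"
  shows "integrable R f"
proof (rule R.integrable_const_bound)
  show "AE r in R. norm (f r) \<le> B" using R_bdd by eventually_elim (rule assms)
qed (use assms(1) in measurable)

lemma noise_second_moment: "(\<integral>r. (u \<bullet> r)\<^sup>2 \<partial>R) = \<rho>\<^sup>2 * (norm u)\<^sup>2"
proof -
  have int: "integrable R (\<lambda>r. r$i * r$j)" for i j
  proof (rule noise_integrable)
    fix r :: "real^'d" assume r: "norm r \<le> \<rho>max"
    have "\<bar>r$i\<bar> * \<bar>r$j\<bar> \<le> \<rho>max * \<rho>max"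
      using component_le_norm_cart[of r i] component_le_norm_cart[of r j] r
      by (intro mult_mono) auto
    then show "norm (r$i * r$j) \<le> \<rho>max * \<rho>max" by (simp add: abs_mult)
  qed measurable
  have "(\<integral>r. (u \<bullet> r)\<^sup>2 \<partial>R) = (\<integral>r. (\<Sum>i\<in>UNIV. \<Sum>j\<in>UNIV. (u$i * u$j) * (r$i * r$j)) \<partial>R)"
    by (simp add: inner_vec_def power2_eq_square sum_product mult_ac)
  also have "\<dots> = (\<Sum>i\<in>UNIV. \<Sum>j\<in>UNIV. (u$i * u$j) * (\<integral>r. r$i * r$j \<partial>R))"
    by (simp add: Bochner_Integration.integral_sum Bochner_Integration.integrable_sum int)
  also have "\<dots> = (\<Sum>i\<in>UNIV. \<rho>\<^sup>2 * (u$i)\<^sup>2)"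
    by (simp add: R_cov if_distrib power2_eq_square mult_ac cong: if_cong)
  finally show ?thesis by (simp add: norm_vec_sq sum_distrib_left)
qed

text \<open>The zero mean removes the cross term, and the covariance is a multiple of the
  identity.\<close>

lemma noise_shifted:
  shows "integrable R (\<lambda>r. (u \<bullet> (v + r))\<^sup>2)"
    and "(\<integral>r. (u \<bullet> (v + r))\<^sup>2 \<partial>R) = (u \<bullet> v)\<^sup>2 + \<rho>\<^sup>2 * (norm u)\<^sup>2"
proof -
  have i0: "integrable R (\<lambda>r. r)"
    by (rule noise_integrable[where B = \<rho>max]) auto
  have i1: "integrable R (\<lambda>r. u \<bullet> r)" using i0 by simp
  have i2: "integrable R (\<lambda>r. (u \<bullet> r)\<^sup>2)"
  proof (rule noise_integrable)
    fix r :: "real^'d" assume r: "norm r \<le> \<rho>max"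
    have "\<bar>u \<bullet> r\<bar> \<le> norm u * \<rho>max"
      using Cauchy_Schwarz_ineq2[of u r] mult_left_mono[OF r norm_ge_zero[of u]] by linarith
    then show "norm ((u \<bullet> r)\<^sup>2) \<le> (norm u * \<rho>max)\<^sup>2"
      by (metis abs_ge_zero norm_power power_mono real_norm_def)
  qed measurable
  have eq: "(\<lambda>r. (u \<bullet> (v + r))\<^sup>2) = (\<lambda>r. (u \<bullet> v)\<^sup>2 + (2 * (u \<bullet> v) * (u \<bullet> r) + (u \<bullet> r)\<^sup>2))"
    by (simp add: fun_eq_iff inner_add_right power2_eq_square algebra_simps)
  show "integrable R (\<lambda>r. (u \<bullet> (v + r))\<^sup>2)" unfolding eq using i1 i2 by auto
  have "(\<integral>r. u \<bullet> r \<partial>R) = 0" using i0 by (simp add: R_mean)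
  then show "(\<integral>r. (u \<bullet> (v + r))\<^sup>2 \<partial>R) = (u \<bullet> v)\<^sup>2 + \<rho>\<^sup>2 * (norm u)\<^sup>2"
    unfolding eq using i1 i2 by (simp add: noise_second_moment R.prob_space)
qed

lemma noise_analysis_integrable:
  assumes "\<Psi> \<in> dictionary"
  shows "integrable R (\<lambda>r. analysis_linf_sq \<Psi> (v + r))"
proof (rule noise_integrable)
  fix r :: "real^'d" assume r: "norm r \<le> \<rho>max"
  have "analysis_linf_sq \<Psi> (v + r) \<le> (norm (v + r))\<^sup>2" by (rule analysis_linf_sq_le[OF assms])
  also have "\<dots> \<le> (norm v + \<rho>max)\<^sup>2"
    using norm_triangle_ineq[of v r] r by (intro power_mono) auto
  finally show "norm (analysis_linf_sq \<Psi> (v + r)) \<le> (norm v + \<rho>max)\<^sup>2"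
    by (simp add: analysis_linf_sq_nonneg)
qed measurable

text \<open>For a unit vector \<open>u\<close> the noise contributes \<open>\<rho>\<^sup>2\<close>
  whatever the dictionary, so it cancels when two objectives are compared.\<close>

lemma sum_signs_second_moment:
  "(\<Sum>s\<in>signs. \<integral>r. (u \<bullet> (synth \<Phi> (flip s x) + r))\<^sup>2 \<partial>R)
   = real (card (signs :: ('k::finite \<Rightarrow> real) set)) *
       ((\<Sum>j\<in>UNIV. (x$j)\<^sup>2 * (u \<bullet> \<Phi> j)\<^sup>2) + \<rho>\<^sup>2 * (norm u)\<^sup>2)"
  for \<Phi> :: "'k::finite \<Rightarrow> real^'d"
  by (simp only: noise_shifted synth_flip sum.distrib sum_signs_square)
     (simp add: algebra_simps power_mult_distrib)

end

section \<open>Moments of a symmetric coefficient distribution\<close>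

context
  fixes nu :: "(real^'k::finite) measure"
  assumes nu_prob: "prob_space nu" and nu_sets [measurable_cong]: "sets nu = sets borel"
    and nu_sphere: "AE x in nu. norm x = 1"
    and nu_sym: "symmetric_measure nu"
begin

interpretation nu: prob_space nu by (rule nu_prob)

lemma integral_flip:
  fixes f :: "real^'k \<Rightarrow> real"
  assumes "integrable nu f" "s \<in> signs"
  shows "integrable nu (\<lambda>x. f (flip s x))" "(\<integral>x. f (flip s x) \<partial>nu) = integral\<^sup>L nu f"
proof -
  have d: "distr nu borel (flip s) = nu"
    using nu_sym assms(2) unfolding symmetric_measure_def flip_def[abs_def] signs_def by auto
  have [measurable]: "f \<in> borel_measurable borel"
    using assms(1) measurable_cong_sets[OF nu_sets refl] by auto
  show "integrable nu (\<lambda>x. f (flip s x))"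
    using assms(1) by (subst (asm) d[symmetric], subst (asm) integrable_distr_eq) auto
  show "(\<integral>x. f (flip s x) \<partial>nu) = integral\<^sup>L nu f"
    by (subst (2) d[symmetric], subst integral_distr) auto
qed

lemma integral_permute:
  fixes f :: "real^'k \<Rightarrow> real"
  assumes [measurable]: "f \<in> borel_measurable borel" and "bij p"
  shows "(\<integral>x. f (\<chi> i. x$(p i)) \<partial>nu) = integral\<^sup>L nu f"
proof -
  have d: "distr nu borel (\<lambda>x. \<chi> i. x$(p i)) = nu"
    using nu_sym assms(2) unfolding symmetric_measure_def by auto
  show ?thesis
    by (subst (2) d[symmetric], subst integral_distr) auto
qed

lemma sphere_integrable:
  fixes f :: "real^'k \<Rightarrow> real"
  assumes "f \<in> borel_measurable borel" "\<And>x. norm x = 1 \<Longrightarrow> \<bar>f x\<bar> \<le> B"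
  shows "integrable nu f"
proof (rule nu.integrable_const_bound)
  show "AE x in nu. norm (f x) \<le> B" using nu_sphere by eventually_elim (simp add: assms)
qed (use assms(1) in measurable)

lemma linf_norm_sq_integrable: "integrable nu (\<lambda>x. (linf_norm x)\<^sup>2)"
proof (rule sphere_integrable)
  fix x :: "real^'k" assume x: "norm x = 1"
  have "linf_norm x \<in> range (\<lambda>i. \<bar>x$i\<bar>)"
    unfolding linf_norm_def by (intro Max_in) auto
  then obtain i where "linf_norm x = \<bar>x$i\<bar>" by blast
  then show "\<bar>(linf_norm x)\<^sup>2\<bar> \<le> 1"
    using component_le_norm_cart[of x i] x by (simp add: abs_square_le_1)
qed measurable

lemma dominant_moment_integrable: "integrable nu (\<lambda>x. indicator (dominant i) x * (x$j)\<^sup>2)"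
proof (rule sphere_integrable)
  fix x :: "real^'k" assume x: "norm x = 1"
  show "\<bar>indicator (dominant i) x * (x$j)\<^sup>2\<bar> \<le> 1"
    using component_le_norm_cart[of x j] x by (simp add: abs_square_le_1 indicator_def)
qed measurable

lemma dominant_moment_permute:
  assumes "bij p"
  shows "(\<integral>x. indicator (dominant (p i)) x * (x$(p j))\<^sup>2 \<partial>nu)
    = (\<integral>x. indicator (dominant i) x * (x$j)\<^sup>2 \<partial>nu)"
  by (subst (2) integral_permute[OF _ assms, symmetric])
     (auto simp: indicator_def dominant_permute[OF assms] intro!: arg_cong[where f = "integral\<^sup>L nu"])

lemma dominant_prob_permute:
  assumes "bij p"
  shows "measure nu (dominant (p i)) = measure nu (dominant i)"
proof -
  have [simp]: "space nu = UNIV" using sets_eq_imp_space_eq[OF nu_sets] by simp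
  have "(\<lambda>x. indicator (dominant i) (\<chi> k. x$(p k)) :: real) = indicator (dominant (p i))"
    by (auto simp: fun_eq_iff indicator_def dominant_permute[OF assms])
  then show ?thesis
    using integral_permute[of "indicator (dominant i)" p] assms by simp
qed

text \<open>Transpositions make all dominant sets equally likely with equal diagonal moments. They
  cover almost everything, so each has probability \<open>1/K\<close>, and the diagonal moments add
  up to \<open>c\<close>.\<close>

lemma dominant_moments:
  assumes K2: "CARD('k) \<ge> 2"
    and dom: "AE x in nu. \<exists>i. x \<in> dominant i"
    and c: "(\<integral>x. (linf_norm x)\<^sup>2 \<partial>nu) = c"
  shows "(\<integral>x. indicator (dominant i) x * (x$i)\<^sup>2 \<partial>nu) = c / real CARD('k)"
    and "j \<noteq> i \<Longrightarrow> (\<integral>x. indicator (dominant i) x * (x$j)\<^sup>2 \<partial>nu)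
           = (1 - c) / (real CARD('k) * (real CARD('k) - 1))"
proof -
  let ?q = "\<lambda>i j. \<integral>x. indicator (dominant i) x * (x$j)\<^sup>2 \<partial>nu"
  let ?p = "\<lambda>i. measure nu (dominant i)"
  have sp [simp]: "space nu = UNIV" using sets_eq_imp_space_eq[OF nu_sets] by simp
  have diag: "?q k k = ?q i i" for k
    using dominant_moment_permute[of "Transposition.transpose i k" i i] by simp
  have "c = (\<integral>x. (\<Sum>k\<in>UNIV. indicator (dominant k) x * (x$k)\<^sup>2) \<partial>nu)"
    unfolding c[symmetric]
  proof (intro integral_cong_AE)
    show "AE x in nu. (linf_norm x)\<^sup>2 = (\<Sum>k\<in>UNIV. indicator (dominant k) x * (x$k)\<^sup>2)"
      using dom
    proof eventually_elim
      fix x :: "real^'k" assume "\<exists>i. x \<in> dominant i"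
      then obtain i where "x \<in> dominant i" ..
      then show "(linf_norm x)\<^sup>2 = (\<Sum>k\<in>UNIV. indicator (dominant k) x * (x$k)\<^sup>2)"
        by (simp only: sum_dominant linf_norm_dominant power2_abs)
    qed
  qed measurable
  also have "\<dots> = (\<Sum>k\<in>UNIV. ?q k k)"
    by (intro Bochner_Integration.integral_sum dominant_moment_integrable)
  also have "\<dots> = (\<Sum>k\<in>(UNIV::'k set). ?q i i)" by (intro sum.cong refl diag)
  also have "\<dots> = real CARD('k) * ?q i i" by simp
  finally show qi: "?q i i = c / real CARD('k)" by simp
  have pk: "?p k = ?p i" for k
    using dominant_prob_permute[of "Transposition.transpose i k" i] by simp
  have "1 = (\<integral>x. (\<Sum>k\<in>UNIV. indicator (dominant k) x * (1::real)) \<partial>nu)"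
  proof -
    have "(\<integral>x. 1 \<partial>nu) = (\<integral>x. (\<Sum>k\<in>UNIV. indicator (dominant k) x * (1::real)) \<partial>nu)"
    proof (intro integral_cong_AE)
      show "AE x in nu. 1 = (\<Sum>k\<in>UNIV. indicator (dominant k) x * (1::real))"
        using dom
      proof eventually_elim
        fix x :: "real^'k" assume "\<exists>i. x \<in> dominant i"
        then obtain i where "x \<in> dominant i" ..
        then show "1 = (\<Sum>k\<in>UNIV. indicator (dominant k) x * (1::real))"
          by (simp only: sum_dominant)
      qed
    qed measurable
    then show ?thesis using nu.prob_space by simp
  qed
  also have "\<dots> = (\<Sum>k\<in>UNIV. \<integral>x. indicator (dominant k) x * (1::real) \<partial>nu)"
    by (intro Bochner_Integration.integral_sum sphere_integrable[where B = 1])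
       (auto simp: indicator_def)
  also have "\<dots> = (\<Sum>k\<in>UNIV. ?p k)" by simp
  also have "\<dots> = (\<Sum>k\<in>(UNIV::'k set). ?p i)" by (intro sum.cong refl pk)
  also have "\<dots> = real CARD('k) * ?p i" by simp
  finally have pi: "?p i = 1 / real CARD('k)" by (simp add: field_simps)
  assume ji: "j \<noteq> i"
  \<comment> \<open>Transposing \<open>j\<close> and \<open>k\<close> fixes \<open>i\<close>, so it
    moves the coordinate but not the dominant set.\<close>
  have off: "?q i k = ?q i j" if "k \<noteq> i" for k
    using dominant_moment_permute[of "Transposition.transpose j k" i j] ji that by simp
  \<comment> \<open>Since \<open>norm x = 1\<close>, the probability \<open>1/K\<close> is the
    diagonal moment plus \<open>K - 1\<close> equal off-diagonal ones.\<close>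
  have "?p i = (\<integral>x. indicator (dominant i) x \<partial>nu)" by simp
  also have "\<dots> = (\<integral>x. (\<Sum>k\<in>UNIV. indicator (dominant i) x * (x$k)\<^sup>2) \<partial>nu)"
  proof (intro integral_cong_AE)
    show "AE x in nu. indicator (dominant i) x = (\<Sum>k\<in>UNIV. indicator (dominant i) x * (x$k)\<^sup>2)"
      using nu_sphere
    proof eventually_elim
      fix x :: "real^'k" assume "norm x = 1"
      then have "(\<Sum>k\<in>UNIV. (x$k)\<^sup>2) = 1" using norm_vec_sq[of x] by simp
      then show "indicator (dominant i) x = (\<Sum>k\<in>UNIV. indicator (dominant i) x * (x$k)\<^sup>2)"
        by (simp only: sum_distrib_left[symmetric] mult_1_right)
    qed
  qed measurable
  also have "\<dots> = (\<Sum>k\<in>UNIV. ?q i k)"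
    by (intro Bochner_Integration.integral_sum dominant_moment_integrable)
  also have "\<dots> = ?q i i + (\<Sum>k\<in>UNIV-{i}. ?q i k)"
    by (subst sum.remove[of _ i]) auto
  also have "(\<Sum>k\<in>UNIV-{i}. ?q i k) = (\<Sum>k\<in>UNIV-{i}. ?q i j)"
    by (intro sum.cong refl off) auto
  also have "\<dots> = (real CARD('k) - 1) * ?q i j"
    using K2 by (simp add: of_nat_diff)
  finally have "(real CARD('k) - 1) * ?q i j = (1 - c) / real CARD('k)"
    using qi pi by (simp add: diff_divide_distrib)
  then show "?q i j = (1 - c) / (real CARD('k) * (real CARD('k) - 1))"
    using K2 by (simp add: field_simps)
qed

end

section \<open>Comparison of the objectives\<close>

text \<open>The frame identity at an atom of the frame contains that atom's own term, which is
  1.\<close>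

lemma frame_constant_ge_1:
  fixes \<Phi> :: "'k::finite \<Rightarrow> real^'d"
  assumes "unit_norm_tight_frame \<Phi> A"
  shows "1 \<le> A"
proof -
  fix i :: 'k
  have n: "norm (\<Phi> i) = 1" using assms by (simp add: unit_norm_tight_frame_def dictionary_def)
  then have "1 = (\<Phi> i \<bullet> \<Phi> i)\<^sup>2" by (simp add: dot_square_norm)
  also have "\<dots> \<le> (\<Sum>j\<in>UNIV. (\<Phi> j \<bullet> \<Phi> i)\<^sup>2)"
    by (rule member_le_sum) auto
  also have "\<dots> = A" using assms n by (simp add: unit_norm_tight_frame_def)
  finally show ?thesis .
qed

lemma inner_le_coherence:
  assumes "j \<noteq> k"
  shows "\<bar>\<Phi> j \<bullet> \<Phi> k\<bar> \<le> coherence \<Phi>"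
proof -
  have "finite {\<bar>\<Phi> i \<bullet> \<Phi> j\<bar> | i j. i \<noteq> j}"
    by (rule finite_subset[of _ "range (\<lambda>(i, j). \<bar>\<Phi> i \<bullet> \<Phi> j\<bar>)"]) auto
  then show ?thesis
    unfolding coherence_def using assms by (intro Max_ge) auto
qed

lemma coherence_ge_0:
  fixes \<Phi> :: "'k::finite \<Rightarrow> real^'d"
  assumes "CARD('k) \<ge> 2"
  shows "0 \<le> coherence \<Phi>"
proof -
  have "\<not> CARD('k) \<le> Suc 0" using assms by simp
  then obtain j k :: 'k where "j \<noteq> k"
    by (subst (asm) card_le_Suc0_iff_eq) auto
  from inner_le_coherence[OF this, of \<Phi>] show ?thesis by linarith
qed

context
  fixes \<Phi> :: "'k::finite \<Rightarrow> real^'d"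
    and nu :: "(real^'k) measure"
    and R :: "(real^'d) measure"
    and A \<mu> \<rho> \<rho>max c1bar \<beta> :: real
  assumes K2: "CARD('k) \<ge> 2"
    and frame: "unit_norm_tight_frame \<Phi> A"
    and mu_def: "\<mu> = coherence \<Phi>"
    and R_prob: "prob_space R" and R_sets [measurable_cong]: "sets R = sets borel"
    and R_bdd: "AE r in R. norm r \<le> \<rho>max"
    and R_mean: "integral\<^sup>L R (\<lambda>r. r) = 0"
    and R_cov: "\<forall>i j. integral\<^sup>L R (\<lambda>r. r$i * r$j) = (if i = j then \<rho>^2 else 0)"
    and nu_prob: "prob_space nu" and nu_sets [measurable_cong]: "sets nu = sets borel"
    and nu_sphere: "AE x in nu. norm x = 1"
    and nu_sym: "symmetric_measure nu"
    and c1bar: "integral\<^sup>L nu (\<lambda>x. (linf_norm x)^2) = c1bar^2"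
    and beta_lt: "\<beta> < 1/2"
    and gap: "AE x in nu. cc x 1 - cc x 2 > 0 \<and>
               (cc x 2 + \<mu> * c_l1 x + \<rho>max) / (cc x 1 - cc x 2) \<le> \<beta>"
begin

interpretation R: prob_space R by (rule R_prob)
interpretation nu: prob_space nu by (rule nu_prob)
interpretation pr: pair_prob_space nu R ..

lemma frame_dictionary: "\<Phi> \<in> dictionary"
  and frame_eq: "(\<Sum>i\<in>UNIV. (\<Phi> i \<bullet> v)\<^sup>2) = A * (norm v)\<^sup>2"
  using frame by (auto simp: unit_norm_tight_frame_def)

lemma coherence_nonneg: "0 \<le> \<mu>"
  unfolding mu_def by (rule coherence_ge_0[OF K2])

lemma frame_constant: "1 \<le> A"
  by (rule frame_constant_ge_1[OF frame])

text \<open>The working form of \<open>gap\<close>: the sorted list is replaced by a dominant index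
  with a bound on the other coordinates, and the positive denominator is cleared.\<close>

lemma dominant_gap:
  "AE x in nu. norm x = 1 \<and> (\<exists>i c2. x \<in> dominant i \<and> (\<forall>j. j \<noteq> i \<longrightarrow> \<bar>x$j\<bar> \<le> c2) \<and> 0 \<le> c2 \<and> c2 < \<bar>x$i\<bar> \<and>
     c2 + \<mu> * (\<Sum>j\<in>UNIV. \<bar>x$j\<bar>) + \<rho>max \<le> \<beta> * (\<bar>x$i\<bar> - c2))"
  using gap nu_sphere
proof eventually_elim
  fix x :: "real^'k"
  assume g: "cc x 1 - cc x 2 > 0 \<and> (cc x 2 + \<mu> * c_l1 x + \<rho>max) / (cc x 1 - cc x 2) \<le> \<beta>"
    and n: "norm x = 1"
  obtain i where i: "cc x 1 = \<bar>x$i\<bar>" "\<And>j. j \<noteq> i \<Longrightarrow> \<bar>x$j\<bar> \<le> cc x 2" "0 \<le> cc x 2"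
    "c_l1 x = (\<Sum>j\<in>UNIV. \<bar>x$j\<bar>)"
    using crearr_props[OF K2, of x] by metis
  have "x \<in> dominant i" using i g by (force simp: dominant_def)
  moreover have "cc x 2 + \<mu> * (\<Sum>j\<in>UNIV. \<bar>x$j\<bar>) + \<rho>max \<le> \<beta> * (\<bar>x$i\<bar> - cc x 2)"
    using g pos_divide_le_eq[of "cc x 1 - cc x 2"] unfolding i(1,4) by blast
  moreover have "cc x 2 < \<bar>x$i\<bar>" using g i by simp
  ultimately show "norm x = 1 \<and> (\<exists>i c2. x \<in> dominant i \<and> (\<forall>j. j \<noteq> i \<longrightarrow> \<bar>x$j\<bar> \<le> c2) \<and> 0 \<le> c2 \<and> c2 < \<bar>x$i\<bar> \<and>
     c2 + \<mu> * (\<Sum>j\<in>UNIV. \<bar>x$j\<bar>) + \<rho>max \<le> \<beta> * (\<bar>x$i\<bar> - c2))"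
    using i n by blast
qed

lemma dominant_exists: "AE x in nu. \<exists>i. x \<in> dominant i"
  using dominant_gap by eventually_elim blast

lemma noise_bound_nonneg: "0 \<le> \<rho>max"
proof -
  have "AE r in R. 0 \<le> \<rho>max"
    using R_bdd by eventually_elim (use norm_ge_zero order_trans in blast)
  then show ?thesis by simp
qed

text \<open>From \<open>\<beta> < 1/2\<close> the gap gives \<open>c2 \<le> (c1 - c2) / 2\<close>,
  hence \<open>c2 \<le> c1 / 3\<close>. The \<open>K - 1\<close> small coefficients then have
  squares at most \<open>c1\<^sup>2 / 9\<close>, and integrating the resulting pointwise bounds
  finishes.\<close>

lemma c1bar_bounds: "0 < c1bar\<^sup>2" "c1bar\<^sup>2 \<le> 1"
  and tail_energy_le: "1 - c1bar\<^sup>2 \<le> (real CARD('k) - 1) * c1bar\<^sup>2 / 9"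
proof -
  note int = linf_norm_sq_integrable[OF nu_prob nu_sets nu_sphere nu_sym]
  have *: "AE x in nu. (linf_norm x)\<^sup>2 \<le> 1 \<and>
      1 - (linf_norm x)\<^sup>2 \<le> (real CARD('k) - 1) / 9 * (linf_norm x)\<^sup>2"
    using dominant_gap
  proof (eventually_elim, elim conjE exE)
    fix x :: "real^'k" and i c2
    assume n: "norm x = 1" and dom: "x \<in> dominant i"
      and c2: "\<forall>j. j \<noteq> i \<longrightarrow> \<bar>x$j\<bar> \<le> c2" "0 \<le> c2" "c2 < \<bar>x$i\<bar>"
      and g: "c2 + \<mu> * (\<Sum>j\<in>UNIV. \<bar>x$j\<bar>) + \<rho>max \<le> \<beta> * (\<bar>x$i\<bar> - c2)"
    have "0 \<le> \<mu> * (\<Sum>j\<in>UNIV. \<bar>x$j\<bar>)"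
      using coherence_nonneg by (intro mult_nonneg_nonneg sum_nonneg) auto
    then have "c2 \<le> \<beta> * (\<bar>x$i\<bar> - c2)" using g noise_bound_nonneg by linarith
    also have "\<dots> \<le> 1/2 * (\<bar>x$i\<bar> - c2)" using beta_lt c2 by (intro mult_right_mono) auto
    finally have c3: "c2 \<le> \<bar>x$i\<bar> / 3" by simp
    have "1 = (\<Sum>j\<in>UNIV. (x$j)\<^sup>2)" using n norm_vec_sq[of x] by simp
    also have "\<dots> = (x$i)\<^sup>2 + (\<Sum>j\<in>UNIV-{i}. (x$j)\<^sup>2)" by (subst sum.remove[of _ i]) auto
    finally have split: "1 = (x$i)\<^sup>2 + (\<Sum>j\<in>UNIV-{i}. (x$j)\<^sup>2)" .
    have "(\<Sum>j\<in>UNIV-{i}. (x$j)\<^sup>2) \<le> (\<Sum>j\<in>UNIV-{i}. (\<bar>x$i\<bar> / 3)\<^sup>2)"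
    proof (intro sum_mono)
      fix j assume "j \<in> UNIV - {i}"
      then have "\<bar>x$j\<bar> \<le> \<bar>x$i\<bar> / 3" using c2 c3 by force
      then show "(x$j)\<^sup>2 \<le> (\<bar>x$i\<bar> / 3)\<^sup>2" by (metis abs_ge_zero power2_abs power_mono)
    qed
    also have "\<dots> = (real CARD('k) - 1) / 9 * (x$i)\<^sup>2"
      using K2 by (simp add: of_nat_diff power_divide)
    finally have "(\<Sum>j\<in>UNIV-{i}. (x$j)\<^sup>2) \<le> (real CARD('k) - 1) / 9 * (x$i)\<^sup>2" .
    moreover have "0 \<le> (\<Sum>j\<in>UNIV-{i}. (x$j)\<^sup>2)" by (intro sum_nonneg) auto
    ultimately show "(linf_norm x)\<^sup>2 \<le> 1 \<and>
      1 - (linf_norm x)\<^sup>2 \<le> (real CARD('k) - 1) / 9 * (linf_norm x)\<^sup>2"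
      unfolding linf_norm_dominant[OF dom] power2_abs using split by linarith
  qed
  have "(\<integral>x. (linf_norm x)\<^sup>2 \<partial>nu) \<le> (\<integral>x. 1 \<partial>nu)"
    using * int by (intro integral_mono_AE) auto
  then show "c1bar\<^sup>2 \<le> 1" using c1bar nu.prob_space by simp
  have "(\<integral>x. 1 - (linf_norm x)\<^sup>2 \<partial>nu) \<le> (\<integral>x. (real CARD('k) - 1) / 9 * (linf_norm x)\<^sup>2 \<partial>nu)"
    using * int by (intro integral_mono_AE) auto
  then show te: "1 - c1bar\<^sup>2 \<le> (real CARD('k) - 1) * c1bar\<^sup>2 / 9"
    using int by (simp add: c1bar nu.prob_space)
  show "0 < c1bar\<^sup>2"
  proof (rule ccontr)
    assume "\<not> 0 < c1bar\<^sup>2"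
    \<comment> \<open>A vanishing mean would turn \<open>te\<close> into
      \<open>1 \<le> 0\<close>.\<close>
    then have "c1bar\<^sup>2 = 0" by simp
    with te show False by simp
  qed
qed

text \<open>\<open>lam\<close> is \<open>K\<close> times the difference of the diagonal and
  off-diagonal moments. The lower bound makes the gain dominate the error; the upper bound controls
  the logarithm.\<close>

lemma lambda_bounds:
  defines "lam \<equiv> c1bar\<^sup>2 - (1 - c1bar\<^sup>2) / (real CARD('k) - 1)"
  shows "8/9 * c1bar\<^sup>2 \<le> lam" "lam \<le> 1" "0 < lam"
proof -
  have K: "real CARD('k) - 1 > 0" using K2 by simp
  have "(1 - c1bar\<^sup>2) / (real CARD('k) - 1) \<le> c1bar\<^sup>2 / 9"
    using tail_energy_le K by (simp add: field_simps)
  then show *: "8/9 * c1bar\<^sup>2 \<le> lam" by (simp add: lam_def)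
  have "0 \<le> (1 - c1bar\<^sup>2) / (real CARD('k) - 1)" using K c1bar_bounds by simp
  then show "lam \<le> 1" using c1bar_bounds unfolding lam_def by linarith
  show "0 < lam" using * c1bar_bounds by linarith
qed

section \<open>Fubini and averaging over signs\<close>

lemma objective_iterated:
  assumes \<Psi>: "\<Psi> \<in> dictionary"
  shows "integrable nu (\<lambda>x. \<integral>r. analysis_linf_sq \<Psi> (synth \<Phi> x + r) \<partial>R)"
    and "objective \<Phi> nu R \<Psi> = (\<integral>x. (\<integral>r. analysis_linf_sq \<Psi> (synth \<Phi> x + r) \<partial>R) \<partial>nu)"
proof -
  let ?F = "\<lambda>(x, r). analysis_linf_sq \<Psi> (synth \<Phi> x + r)"
  have "integrable (nu \<Otimes>\<^sub>M R) ?F"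
  proof (rule pr.integrable_const_bound)
    \<comment> \<open>Almost surely the signal has norm at most \<open>K + \<rho>max\<close>, as the
      atoms have norm 1 and the coefficients lie on the sphere.\<close>
    show "AE p in nu \<Otimes>\<^sub>M R. norm (?F p) \<le> (real CARD('k) + \<rho>max)\<^sup>2"
    proof (rule pr.AE_pair_measure)
      show "{p \<in> space (nu \<Otimes>\<^sub>M R). norm (?F p) \<le> (real CARD('k) + \<rho>max)\<^sup>2} \<in> sets (nu \<Otimes>\<^sub>M R)"
        by measurable
      show "AE x in nu. AE r in R. norm (?F (x, r)) \<le> (real CARD('k) + \<rho>max)\<^sup>2"
        using nu_sphere
      proof eventually_elim
        fix x :: "real^'k" assume x: "norm x = 1"
        show "AE r in R. norm (?F (x, r)) \<le> (real CARD('k) + \<rho>max)\<^sup>2"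
          using R_bdd
        proof eventually_elim
          fix r :: "real^'d" assume r: "norm r \<le> \<rho>max"
          have "norm (synth \<Phi> x + r) \<le> real CARD('k) + \<rho>max"
            using norm_triangle_ineq[of "synth \<Phi> x" r] norm_synth_le[OF frame_dictionary x] r by linarith
          then have "(norm (synth \<Phi> x + r))\<^sup>2 \<le> (real CARD('k) + \<rho>max)\<^sup>2"
            by (intro power_mono) auto
          then show "norm (?F (x, r)) \<le> (real CARD('k) + \<rho>max)\<^sup>2"
            using analysis_linf_sq_le[OF \<Psi>, of "synth \<Phi> x + r"]
            by (simp add: analysis_linf_sq_nonneg)
        qed
      qed
    qed
  qed measurable
  then show "integrable nu (\<lambda>x. \<integral>r. analysis_linf_sq \<Psi> (synth \<Phi> x + r) \<partial>R)"
    and "objective \<Phi> nu R \<Psi> = (\<integral>x. (\<integral>r. analysis_linf_sq \<Psi> (synth \<Phi> x + r) \<partial>R) \<partial>nu)"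
    using pr.integrable_fst'[of ?F] pr.integral_fst'[of ?F] by (auto simp: objective_def)
qed

text \<open>Each sign pattern leaves \<open>nu\<close> invariant, so the objective may be estimated
  through sign sums at a fixed \<open>x\<close>.\<close>

lemma objective_symmetrized:
  fixes \<Psi> :: "'k \<Rightarrow> real^'d"
  assumes \<Psi>: "\<Psi> \<in> dictionary"
  defines "G \<equiv> \<lambda>x. \<Sum>s\<in>signs. \<integral>r. analysis_linf_sq \<Psi> (synth \<Phi> (flip s x) + r) \<partial>R"
  shows "integrable nu G"
    and "real (card (signs :: ('k \<Rightarrow> real) set)) * objective \<Phi> nu R \<Psi> = integral\<^sup>L nu G"
proof -
  note fl = integral_flip[OF nu_prob nu_sets nu_sphere nu_sym objective_iterated(1)[OF \<Psi>]]
  show "integrable nu G" unfolding G_def by (intro Bochner_Integration.integrable_sum fl)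
  have "integral\<^sup>L nu G = (\<Sum>s\<in>(signs :: ('k \<Rightarrow> real) set). objective \<Phi> nu R \<Psi>)"
    unfolding G_def
    by (subst Bochner_Integration.integral_sum) (auto simp: fl objective_iterated(2)[OF \<Psi>])
  then show "real (card (signs :: ('k \<Rightarrow> real) set)) * objective \<Phi> nu R \<Psi> = integral\<^sup>L nu G"
    by simp
qed

text \<open>The sign average of the squared noiseless response of the atom at the dominant index,
  that is, of an oracle that always selects this atom.\<close>

definition energy :: "('k \<Rightarrow> real^'d) \<Rightarrow> real^'k \<Rightarrow> real" where
  "energy \<Psi> x = (\<Sum>i\<in>UNIV. indicator (dominant i) x * (\<Sum>j\<in>UNIV. (x$j)\<^sup>2 * (\<Psi> i \<bullet> \<Phi> j)\<^sup>2))"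

text \<open>The moments take only the values \<open>p\<close> and \<open>q\<close>. Giving weight
  \<open>q\<close> to every \<open>j\<close> produces a full frame sum, equal to \<open>A\<close>
  for any unit atom; only the surplus \<open>p - q\<close> at \<open>j = i\<close> sees the
  dictionary.\<close>

lemma energy_integral:
  assumes \<Psi>: "\<Psi> \<in> dictionary"
  defines "p \<equiv> c1bar\<^sup>2 / real CARD('k)"
    and "q \<equiv> (1 - c1bar\<^sup>2) / (real CARD('k) * (real CARD('k) - 1))"
  shows "integrable nu (energy \<Psi>)"
    and "integral\<^sup>L nu (energy \<Psi>) = (\<Sum>i\<in>UNIV. (p - q) * (\<Psi> i \<bullet> \<Phi> i)\<^sup>2 + q * A)"
proof -
  note int = dominant_moment_integrable[OF nu_prob nu_sets nu_sphere nu_sym]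
  note mom = dominant_moments[OF nu_prob nu_sets nu_sphere nu_sym K2 dominant_exists c1bar]
  have e: "energy \<Psi> = (\<lambda>x. \<Sum>i\<in>UNIV. \<Sum>j\<in>UNIV. (\<Psi> i \<bullet> \<Phi> j)\<^sup>2 * (indicator (dominant i) x * (x$j)\<^sup>2))"
    by (simp add: energy_def fun_eq_iff sum_distrib_left mult_ac)
  show "integrable nu (energy \<Psi>)"
    unfolding e by (intro Bochner_Integration.integrable_sum integrable_mult_right int)
  have "integral\<^sup>L nu (energy \<Psi>)
      = (\<Sum>i\<in>UNIV. \<Sum>j\<in>UNIV. (\<Psi> i \<bullet> \<Phi> j)\<^sup>2 * (\<integral>x. indicator (dominant i) x * (x$j)\<^sup>2 \<partial>nu))"
    unfolding e
    by (simp only: Bochner_Integration.integral_sum Bochner_Integration.integrable_sum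
          integrable_mult_right int integral_mult_right_zero)
  also have "\<dots> = (\<Sum>i\<in>UNIV. (p - q) * (\<Psi> i \<bullet> \<Phi> i)\<^sup>2 + q * A)"
  proof (intro sum.cong refl)
    fix i
    have "(\<Sum>j\<in>UNIV. (\<Psi> i \<bullet> \<Phi> j)\<^sup>2 * (\<integral>x. indicator (dominant i) x * (x$j)\<^sup>2 \<partial>nu))
        = (\<Sum>j\<in>UNIV. (if j = i then (p - q) * (\<Psi> i \<bullet> \<Phi> i)\<^sup>2 else 0) + q * (\<Phi> j \<bullet> \<Psi> i)\<^sup>2)"
    proof (intro sum.cong refl)
      fix j
      show "(\<Psi> i \<bullet> \<Phi> j)\<^sup>2 * (\<integral>x. indicator (dominant i) x * (x$j)\<^sup>2 \<partial>nu)
          = (if j = i then (p - q) * (\<Psi> i \<bullet> \<Phi> i)\<^sup>2 else 0) + q * (\<Phi> j \<bullet> \<Psi> i)\<^sup>2"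
      proof (cases "j = i")
        case True
        then show ?thesis
          by (simp only: mom(1) if_True p_def[symmetric] inner_commute) (simp add: algebra_simps)
      next
        case False
        then show ?thesis
          by (simp only: mom(2)[OF False] if_False q_def[symmetric] inner_commute) simp
      qed
    qed
    also have "\<dots> = (p - q) * (\<Psi> i \<bullet> \<Phi> i)\<^sup>2 + q * (\<Sum>j\<in>UNIV. (\<Phi> j \<bullet> \<Psi> i)\<^sup>2)"
      by (simp add: sum.distrib sum_distrib_left)
    also have "(\<Sum>j\<in>UNIV. (\<Phi> j \<bullet> \<Psi> i)\<^sup>2) = A"
      using frame_eq[of "\<Psi> i"] \<Psi> by (simp add: dictionary_def)
    finally show "(\<Sum>j\<in>UNIV. (\<Psi> i \<bullet> \<Phi> j)\<^sup>2 * (\<integral>x. indicator (dominant i) x * (x$j)\<^sup>2 \<partial>nu))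
        = (p - q) * (\<Psi> i \<bullet> \<Phi> i)\<^sup>2 + q * A" .
  qed
  finally show "integral\<^sup>L nu (energy \<Psi>) = (\<Sum>i\<in>UNIV. (p - q) * (\<Psi> i \<bullet> \<Phi> i)\<^sup>2 + q * A)" .
qed

text \<open>The maximum is at least the response of the dominant atom, for every sign
  pattern.\<close>

lemma objective_ge_energy: "integral\<^sup>L nu (energy \<Phi>) + \<rho>\<^sup>2 \<le> objective \<Phi> nu R \<Phi>"
proof -
  let ?N = "real (card (signs :: ('k \<Rightarrow> real) set))"
  let ?G = "\<lambda>x. \<Sum>s\<in>signs. \<integral>r. analysis_linf_sq \<Phi> (synth \<Phi> (flip s x) + r) \<partial>R"
  note ssm = sum_signs_second_moment[OF R_prob R_sets R_bdd R_mean R_cov]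
  note nsh = noise_shifted[OF R_prob R_sets R_bdd R_mean R_cov]
  note nai = noise_analysis_integrable[OF R_prob R_sets R_bdd R_mean R_cov]
  have ae: "AE x in nu. ?N * (energy \<Phi> x + \<rho>\<^sup>2) \<le> ?G x"
    using dominant_exists
  proof eventually_elim
    fix x :: "real^'k" assume "\<exists>i. x \<in> dominant i"
    then obtain i where i: "x \<in> dominant i" ..
    have "?N * (energy \<Phi> x + \<rho>\<^sup>2)
        = (\<Sum>s\<in>signs. \<integral>r. (\<Phi> i \<bullet> (synth \<Phi> (flip s x) + r))\<^sup>2 \<partial>R)"
      unfolding ssm energy_def sum_dominant[OF i] using frame_dictionary by (simp add: dictionary_def)
    also have "\<dots> \<le> ?G x"
      by (intro sum_mono integral_mono nsh nai frame_dictionary analysis_linf_sq_ge)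
    finally show "?N * (energy \<Phi> x + \<rho>\<^sup>2) \<le> ?G x" .
  qed
  have "(\<integral>x. ?N * (energy \<Phi> x + \<rho>\<^sup>2) \<partial>nu) \<le> integral\<^sup>L nu ?G"
    using energy_integral(1)[OF frame_dictionary] objective_symmetrized(1)[OF frame_dictionary] ae
    by (intro integral_mono_AE) auto
  also have "\<dots> = ?N * objective \<Phi> nu R \<Phi>"
    using objective_symmetrized(2)[OF frame_dictionary] by simp
  finally have "?N * (integral\<^sup>L nu (energy \<Phi>) + \<rho>\<^sup>2) \<le> ?N * objective \<Phi> nu R \<Phi>"
    using energy_integral(1)[OF frame_dictionary] by (simp add: nu.prob_space)
  then show ?thesis using card_signs_pos[where 'k = 'k] by simp
qed

lemma objective_le_energy:
  assumes \<Psi>: "\<Psi> \<in> dictionary"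
    and e: "\<And>k. norm (\<Psi> k - \<Phi> k) \<le> e" "0 < e" "e \<le> 1/5"
    and eL: "e * (2 * A * L) \<le> (1 - 2*\<beta>)\<^sup>2"
    and L: "ln (2 * real CARD('k)) \<le> L" "4/3 \<le> L"
  shows "objective \<Phi> nu R \<Psi>
    \<le> integral\<^sup>L nu (energy \<Psi>) + \<rho>\<^sup>2 + e\<^sup>2 / (2 * real CARD('k)) * c1bar\<^sup>2"
proof -
  let ?N = "real (card (signs :: ('k \<Rightarrow> real) set))"
  let ?G = "\<lambda>x. \<Sum>s\<in>signs. \<integral>r. analysis_linf_sq \<Psi> (synth \<Phi> (flip s x) + r) \<partial>R"
  let ?t = "e\<^sup>2 / (2 * real CARD('k))"
  note ssm = sum_signs_second_moment[OF R_prob R_sets R_bdd R_mean R_cov]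
  note nsh = noise_shifted[OF R_prob R_sets R_bdd R_mean R_cov]
  note nai = noise_analysis_integrable[OF R_prob R_sets R_bdd R_mean R_cov]
  note lint = linf_norm_sq_integrable[OF nu_prob nu_sets nu_sphere nu_sym]
  have ae: "AE x in nu. ?G x \<le> ?N * (energy \<Psi> x + \<rho>\<^sup>2 + ?t * (linf_norm x)\<^sup>2)"
    using dominant_gap
  proof (eventually_elim, elim conjE exE)
    fix x :: "real^'k" and i c2
    assume dom: "x \<in> dominant i"
      and c2: "\<forall>j. j \<noteq> i \<longrightarrow> \<bar>x$j\<bar> \<le> c2" "0 \<le> c2" "c2 < \<bar>x$i\<bar>"
      and g: "c2 + \<mu> * (\<Sum>j\<in>UNIV. \<bar>x$j\<bar>) + \<rho>max \<le> \<beta> * (\<bar>x$i\<bar> - c2)"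
    \<comment> \<open>The sign sum moves inside the noise integral because the tail estimate holds
      at each fixed admissible \<open>r\<close>.\<close>
    have "?G x = (\<integral>r. (\<Sum>s\<in>signs. analysis_linf_sq \<Psi> (synth \<Phi> (flip s x) + r)) \<partial>R)"
      by (intro Bochner_Integration.integral_sum[symmetric] nai \<Psi>)
    also have "\<dots> \<le> (\<integral>r. (\<Sum>s\<in>signs. (\<Psi> i \<bullet> (synth \<Phi> (flip s x) + r))\<^sup>2) + ?N * ((x$i)\<^sup>2 * ?t) \<partial>R)"
    proof (intro integral_mono_AE)
      show "AE r in R. (\<Sum>s\<in>signs. analysis_linf_sq \<Psi> (synth \<Phi> (flip s x) + r))
          \<le> (\<Sum>s\<in>signs. (\<Psi> i \<bullet> (synth \<Phi> (flip s x) + r))\<^sup>2) + ?N * ((x$i)\<^sup>2 * ?t)"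
        using R_bdd
      proof eventually_elim
        fix r :: "real^'d" assume r: "norm r \<le> \<rho>max"
        show "(\<Sum>s\<in>signs. analysis_linf_sq \<Psi> (synth \<Phi> (flip s x) + r))
          \<le> (\<Sum>s\<in>signs. (\<Psi> i \<bullet> (synth \<Phi> (flip s x) + r))\<^sup>2) + ?N * ((x$i)\<^sup>2 * ?t)"
          by (rule sum_signs_analysis_le[OF frame_dictionary frame_eq inner_le_coherence[where \<Phi> = \<Phi>, folded mu_def] coherence_nonneg e
                eL L frame_constant beta_lt _ c2(2,3) g r]) (use c2(1) in auto)
      qed
    qed (intro Bochner_Integration.integrable_sum Bochner_Integration.integrable_add nai nsh \<Psi>, simp)+
    also have "\<dots> = (\<Sum>s\<in>signs. \<integral>r. (\<Psi> i \<bullet> (synth \<Phi> (flip s x) + r))\<^sup>2 \<partial>R) + ?N * ((x$i)\<^sup>2 * ?t)"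
      by (subst Bochner_Integration.integral_add, intro Bochner_Integration.integrable_sum nsh, simp,
          subst Bochner_Integration.integral_sum, intro nsh, simp add: R.prob_space)
    also have "\<dots> = ?N * (energy \<Psi> x + \<rho>\<^sup>2 + ?t * (linf_norm x)\<^sup>2)"
      unfolding ssm energy_def sum_dominant[OF dom] linf_norm_dominant[OF dom] using \<Psi>
      by (simp add: dictionary_def algebra_simps)
    finally show "?G x \<le> ?N * (energy \<Psi> x + \<rho>\<^sup>2 + ?t * (linf_norm x)\<^sup>2)" .
  qed
  have "?N * objective \<Phi> nu R \<Psi> = integral\<^sup>L nu ?G"
    by (rule objective_symmetrized(2)[OF \<Psi>])
  also have "\<dots> \<le> (\<integral>x. ?N * (energy \<Psi> x + \<rho>\<^sup>2 + ?t * (linf_norm x)\<^sup>2) \<partial>nu)"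
    using energy_integral(1)[OF \<Psi>] objective_symmetrized(1)[OF \<Psi>] ae lint
    by (intro integral_mono_AE) auto
  also have "\<dots> = ?N * (integral\<^sup>L nu (energy \<Psi>) + \<rho>\<^sup>2 + ?t * c1bar\<^sup>2)"
    using energy_integral(1)[OF \<Psi>] lint by (simp add: nu.prob_space c1bar)
  finally show ?thesis using card_signs_pos[where 'k = 'k] by simp
qed

text \<open>Gain and error are both quadratic in \<open>e\<close>, and the gain has the larger
  constant. Taking \<open>e\<close> as the exact maximal deviation lets a single atom account for
  the whole gain.\<close>

lemma objective_less:
  assumes \<Psi>: "\<Psi> \<in> dictionary"
    and e: "e = Max (range (\<lambda>i. norm (\<Psi> i - \<Phi> i)))" "0 < e" "e \<le> 1/5"
    and eL: "e * (2 * A * L) \<le> (1 - 2*\<beta>)\<^sup>2"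
    and L: "ln (2 * real CARD('k)) \<le> L" "4/3 \<le> L"
  shows "objective \<Phi> nu R \<Psi> < objective \<Phi> nu R \<Phi>"
proof -
  define K where "K = real CARD('k)"
  define p q where "p = c1bar\<^sup>2 / K" and "q = (1 - c1bar\<^sup>2) / (K * (K - 1))"
  have K: "K \<ge> 2" using K2 by (simp add: K_def)
  have ek: "norm (\<Psi> k - \<Phi> k) \<le> e" for k
    unfolding e(1) by (intro Max_ge) auto
  have "e \<in> range (\<lambda>i. norm (\<Psi> i - \<Phi> i))" unfolding e(1) by (intro Max_in) auto
  then obtain k where k: "norm (\<Psi> k - \<Phi> k) = e" by auto
  have corr: "\<Psi> i \<bullet> \<Phi> i = 1 - (norm (\<Psi> i - \<Phi> i))\<^sup>2 / 2" for i
  proof -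
    have "\<Psi> i \<bullet> \<Psi> i = 1" "\<Phi> i \<bullet> \<Phi> i = 1"
      using \<Psi> frame_dictionary by (simp_all add: dictionary_def dot_square_norm)
    then have "(norm (\<Psi> i - \<Phi> i))\<^sup>2 = 2 - 2 * (\<Psi> i \<bullet> \<Phi> i)"
      unfolding power2_norm_eq_inner
      by (simp add: inner_diff_left inner_diff_right inner_commute[of "\<Phi> i" "\<Psi> i"])
    then show ?thesis by linarith
  qed
  have le1: "(\<Psi> i \<bullet> \<Phi> i)\<^sup>2 \<le> 1" for i
    using Cauchy_Schwarz_ineq2[of "\<Psi> i" "\<Phi> i"] \<Psi> frame_dictionary
    by (simp add: dictionary_def abs_square_le_1)
  \<comment> \<open>From \<open>\<psi>\<bullet>\<phi> = 1 - e\<^sup>2/2\<close> the loss of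
    correlation is \<open>e\<^sup>2 - e\<^sup>2 * e\<^sup>2 / 4\<close>, and
    \<open>e \<le> 1/5\<close> makes the correction at most one percent.\<close>
  have "e\<^sup>2 \<le> (1/5)\<^sup>2" using e by (intro power_mono) auto
  then have "e\<^sup>2 * e\<^sup>2 \<le> 1/25 * e\<^sup>2" by (intro mult_right_mono) (auto simp: power2_eq_square)
  moreover have "1 - (\<Psi> k \<bullet> \<Phi> k)\<^sup>2 = e\<^sup>2 - e\<^sup>2 * e\<^sup>2 / 4"
    unfolding corr k by (simp add: power2_eq_square algebra_simps)
  ultimately have gk: "99/100 * e\<^sup>2 \<le> 1 - (\<Psi> k \<bullet> \<Phi> k)\<^sup>2" by simp
  also have "\<dots> \<le> (\<Sum>i\<in>UNIV. 1 - (\<Psi> i \<bullet> \<Phi> i)\<^sup>2)"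
    using le1 by (intro member_le_sum) auto
  finally have gain: "99/100 * e\<^sup>2 \<le> (\<Sum>i\<in>UNIV. 1 - (\<Psi> i \<bullet> \<Phi> i)\<^sup>2)" .
  have pq: "p - q = (c1bar\<^sup>2 - (1 - c1bar\<^sup>2) / (K - 1)) / K"
    using K by (simp add: p_def q_def field_simps)
  have pq_ge: "8/9 * c1bar\<^sup>2 / K \<le> p - q"
    unfolding pq using lambda_bounds(1) K by (intro divide_right_mono) (auto simp: K_def)
  have nn: "\<Phi> i \<bullet> \<Phi> i = 1" for i using frame_dictionary by (simp add: dictionary_def dot_square_norm)
  have "integral\<^sup>L nu (energy \<Phi>) - integral\<^sup>L nu (energy \<Psi>)
      = (p - q) * (\<Sum>i\<in>UNIV. 1 - (\<Psi> i \<bullet> \<Phi> i)\<^sup>2)"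
    unfolding energy_integral(2)[OF \<Psi>] energy_integral(2)[OF frame_dictionary] nn
      K_def[symmetric] p_def[symmetric] q_def[symmetric] sum_subtractf[symmetric] sum_distrib_left
    by (intro sum.cong refl) (simp add: algebra_simps)
  also have "\<dots> \<ge> (8/9 * c1bar\<^sup>2 / K) * (99/100 * e\<^sup>2)"
    using pq_ge gain K by (intro mult_mono order_trans[OF _ pq_ge]) auto
  finally have "integral\<^sup>L nu (energy \<Psi>) + (8/9 * c1bar\<^sup>2 / K) * (99/100 * e\<^sup>2)
      \<le> integral\<^sup>L nu (energy \<Phi>)" by simp
  \<comment> \<open>In units of \<open>e\<^sup>2 * c1bar\<^sup>2 / K\<close> this compares 0.5 with
    0.88.\<close>
  moreover have "e\<^sup>2 / (2 * K) * c1bar\<^sup>2 < (8/9 * c1bar\<^sup>2 / K) * (99/100 * e\<^sup>2)"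
  proof -
    have "0 < e\<^sup>2 * c1bar\<^sup>2 / K" using e c1bar_bounds K by auto
    then show ?thesis by (simp add: field_simps)
  qed
  ultimately show ?thesis
    using objective_ge_energy objective_le_energy[OF \<Psi> ek e(2,3) eL L] unfolding K_def by linarith
qed

text \<open>\<open>lam \<le> 1 \<le> A\<close> makes the argument at least
  \<open>2K \<ge> 4\<close>, and \<open>ln 4 = 2 * ln 2\<close> is at least 4/3.\<close>

lemma log_bounds:
  defines "L \<equiv> ln (2 * A * real CARD('k) / (c1bar\<^sup>2 - (1 - c1bar\<^sup>2) / (real CARD('k) - 1)))"
  shows "ln (2 * real CARD('k)) \<le> L" "4/3 \<le> L"
proof -
  define lam where "lam = c1bar\<^sup>2 - (1 - c1bar\<^sup>2) / (real CARD('k) - 1)"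
  have lam: "0 < lam" "lam \<le> 1" using lambda_bounds by (auto simp: lam_def)
  have "2 * 1 * real CARD('k) / 1 \<le> 2 * A * real CARD('k) / lam"
    using lam frame_constant by (intro frac_le mult_right_mono mult_left_mono) auto
  then show *: "ln (2 * real CARD('k)) \<le> L"
    unfolding L_def lam_def[symmetric] using K2 by (intro ln_mono) auto
  have "4/3 \<le> 2 * ln (2::real)" using ln2_ge_two_thirds by simp
  also have "\<dots> = ln 4" using ln_mult[of 2 "2::real"] by simp
  also have "\<dots> \<le> ln (2 * real CARD('k))" using K2 by (intro ln_mono) auto
  finally show "4/3 \<le> L" using * by linarith
qed

end

theorem theorem4:
  fixes \<Phi> :: "'k::finite \<Rightarrow> real^'d"
    and nu :: "(real^'k) measure"
    and R :: "(real^'d) measure"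
    and A \<mu> \<rho> \<rho>max c1bar \<beta> :: real
  assumes K2: "CARD('k) \<ge> 2"
    and A_def: "A = real CARD('k) / real CARD('d)"
    and frame: "unit_norm_tight_frame \<Phi> A"
    and mu_def: "\<mu> = coherence \<Phi>"
    and R_prob: "prob_space R" and R_sets: "sets R = sets borel"
    and R_bdd: "AE r in R. norm r \<le> \<rho>max"
    and R_mean: "integral\<^sup>L R (\<lambda>r. r) = 0"
    and R_cov: "\<forall>i j. integral\<^sup>L R (\<lambda>r. r$i * r$j) = (if i = j then \<rho>^2 else 0)"
    and nu_prob: "prob_space nu" and nu_sets: "sets nu = sets borel"
    and nu_sphere: "AE x in nu. norm x = 1"
    and nu_sym: "symmetric_measure nu"
    and c1bar: "integral\<^sup>L nu (\<lambda>x. (linf_norm x)^2) = c1bar^2"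
    and beta_lt: "\<beta> < 1/2"
    and gap: "AE x in nu. cc x 1 - cc x 2 > 0 \<and>
               (cc x 2 + \<mu> * c_l1 x + \<rho>max) / (cc x 1 - cc x 2) \<le> \<beta>"
  shows "(\<exists>\<delta>>0. \<forall>\<Psi>\<in>dictionary. (\<forall>i. norm (\<Psi> i - \<Phi> i) \<le> \<delta>) \<longrightarrow>
             objective \<Phi> nu R \<Psi> \<le> objective \<Phi> nu R \<Phi>)
      \<and> (\<forall>\<epsilon>::real. \<epsilon> < 1/5 \<and>
           \<epsilon> \<le> (1 - 2*\<beta>)^2 / (2 * A * ln (2 * A * real CARD('k) /
                   (c1bar^2 - (1 - c1bar^2) / (real CARD('k) - 1)))) \<longrightarrow>
           (\<forall>\<Psi>\<in>dictionary.
              0 < Max (range (\<lambda>i. norm (\<Psi> i - \<Phi> i))) \<and>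
              Max (range (\<lambda>i. norm (\<Psi> i - \<Phi> i))) \<le> \<epsilon> \<longrightarrow>
              objective \<Phi> nu R \<Psi> < objective \<Phi> nu R \<Phi>))"
proof -
  note less = objective_less[OF K2 frame mu_def R_prob R_sets R_bdd R_mean R_cov
    nu_prob nu_sets nu_sphere nu_sym c1bar beta_lt gap]
  define L where "L = ln (2 * A * real CARD('k) / (c1bar\<^sup>2 - (1 - c1bar\<^sup>2) / (real CARD('k) - 1)))"
  have L: "ln (2 * real CARD('k)) \<le> L" "4/3 \<le> L" unfolding L_def
    by (rule log_bounds[OF K2 frame mu_def R_prob R_sets R_bdd R_mean R_cov
        nu_prob nu_sets nu_sphere nu_sym c1bar beta_lt gap])+
  have AL: "0 < 2 * A * L" using L frame_constant_ge_1[OF frame] by simp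
  \<comment> \<open>\<open>objective_less\<close> is applied to the actual maximal deviation, which
    inherits both bounds from \<open>\<epsilon>\<close>.\<close>
  have strict: "objective \<Phi> nu R \<Psi> < objective \<Phi> nu R \<Phi>"
    if "\<epsilon> < 1/5" "\<epsilon> \<le> (1 - 2*\<beta>)^2 / (2 * A * L)" "\<Psi> \<in> dictionary"
      "0 < Max (range (\<lambda>i. norm (\<Psi> i - \<Phi> i)))" "Max (range (\<lambda>i. norm (\<Psi> i - \<Phi> i))) \<le> \<epsilon>" for \<epsilon> \<Psi>
  proof (rule less[OF that(3) refl that(4) _ _ L])
    show "Max (range (\<lambda>i. norm (\<Psi> i - \<Phi> i))) \<le> 1/5" using that by linarith
    have "Max (range (\<lambda>i. norm (\<Psi> i - \<Phi> i))) \<le> (1 - 2*\<beta>)^2 / (2 * A * L)" using that by linarith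
    then show "Max (range (\<lambda>i. norm (\<Psi> i - \<Phi> i))) * (2 * A * L) \<le> (1 - 2*\<beta>)\<^sup>2"
      using AL by (simp only: pos_le_divide_eq)
  qed
  \<comment> \<open>1/6 serves as a value strictly below 1/5, so \<open>strict\<close> applies with
    \<open>\<delta>\<close> in the role of \<open>\<epsilon>\<close>.\<close>
  define \<delta> where "\<delta> = min (1/6) ((1 - 2*\<beta>)^2 / (2 * A * L))"
  have "0 < \<delta>" using AL beta_lt by (simp add: \<delta>_def)
  moreover have "objective \<Phi> nu R \<Psi> \<le> objective \<Phi> nu R \<Phi>"
    if \<Psi>: "\<Psi> \<in> dictionary" and d: "\<forall>i. norm (\<Psi> i - \<Phi> i) \<le> \<delta>" for \<Psi>
  proof (cases "\<Psi> = \<Phi>")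
    case False
    \<comment> \<open>Some atom differs, so the maximal deviation is positive; the case
      \<open>\<Psi> = \<Phi>\<close> is an equality.\<close>
    then obtain i where "norm (\<Psi> i - \<Phi> i) > 0" by (auto simp: fun_eq_iff)
    moreover have "norm (\<Psi> i - \<Phi> i) \<le> Max (range (\<lambda>i. norm (\<Psi> i - \<Phi> i)))"
      by (intro Max_ge) auto
    moreover have "Max (range (\<lambda>i. norm (\<Psi> i - \<Phi> i))) \<le> \<delta>"
      using d by (intro Max.boundedI) auto
    moreover have "\<delta> < 1/5" "\<delta> \<le> (1 - 2*\<beta>)^2 / (2 * A * L)" by (auto simp: \<delta>_def)
    ultimately show ?thesis
      using strict[of \<delta> \<Psi>] \<Psi> by linarith
  qed auto
  ultimately show ?thesis
    using strict unfolding L_def[symmetric] by blast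
qed

end
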